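(* Let $d\geq 1$. The function $\mathbf{M}\colon \mathcal{M}_d\times(0,+\infty)\to[-\infty,+\infty)$, $(\mu,s)\mapsto\mathbf{M}(\mu,s)$, is continuous.
   Context: $M_d(\mathbb{R})$ is the space of real $d\times d$ matrices with the operator norm $\|\cdot\|$ induced by the Euclidean norm. $\mathcal{M}_d$ is the set of all Borel probability measures on the closed unit ball of $M_d(\mathbb{R})$, with the weak-* topology (the smallest topology making $\mu\mapsto\int f\,d\mu$ continuous for every real-valued continuous function $f$ on the closed unit ball). For a Borel measure $\mu$ on $M_d(\mathbb{R})$ and $n\ge1$, $\mu_n$ is the push-forward of the $n$-fold product $\mu\times\cdots\times\mu$ under $(A_1,\ldots,A_n)\mapsto A_1\cdots A_n$. The norm pressure is $\mathbf{M}(\mu,s):=\lim_{n\to\infty}\frac1n\log\left(\int\|A\|^s\,d\mu_n(A)\right)\in[-\infty,+\infty)$, where the limit exists by subadditivity and $\log 0:=-\infty$. The target $[-\infty,+\infty)$ has its usual (order) topology and the domain the product topology. *)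

theory Defs
  imports "HOL-Probability.Probability"
begin

definition op_norm :: "real^'n^'n \<Rightarrow> real" where
  "op_norm A = onorm (\<lambda>v. A *v v)"

text \<open>
  The type \<open>real^'n^'n\<close> carries the Frobenius norm; it induces the same topology and Borel sets as
  the operator norm, but the unit ball has to be taken with respect to the operator norm.
\<close>

definition op_unit_ball :: "(real^'n^'n) set" where
  "op_unit_ball = {A. op_norm A \<le> 1}"

definition ball_prob_measures :: "(real^'n^'n) measure set" where
  "ball_prob_measures =
     {\<mu>. prob_space \<mu> \<and> sets \<mu> = sets (restrict_space borel op_unit_ball)}"

text \<open>
  The smallest topology for which every \<open>\<mu> \<mapsto> \<integral>f d\<mu>\<close> is continuous, generated by the preimages of
  open sets.
\<close>

definition weak_star_topology :: "(real^'n^'n) measure topology" where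
  "weak_star_topology = topology_generated_by
     {{\<mu> \<in> ball_prob_measures. (\<integral>A. f A \<partial>\<mu>) \<in> U} | (f :: real^'n^'n \<Rightarrow> real) U.
        continuous_on op_unit_ball f \<and> open U}"

lemma topspace_weak_star_topology: "topspace weak_star_topology = ball_prob_measures"
proof
  show "topspace weak_star_topology \<subseteq> ball_prob_measures"
    by (auto simp: weak_star_topology_def)
  have "ball_prob_measures \<in>
     {{\<mu> \<in> ball_prob_measures. (\<integral>A. f A \<partial>\<mu>) \<in> U} | (f :: real^'n^'n \<Rightarrow> real) U.
        continuous_on op_unit_ball f \<and> open U}"
    by (intro CollectI exI[of _ "\<lambda>_. 0"] exI[of _ UNIV]) auto
  then show "ball_prob_measures \<subseteq> topspace weak_star_topology"
    unfolding weak_star_topology_def topology_generated_by_topspace by (rule Union_upper)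
qed

text \<open>The ordered product \<open>A\<^sub>0 A\<^sub>1 \<dots> A\<^sub>n\<^sub>-\<^sub>1\<close>.\<close>

primrec mat_prod :: "nat \<Rightarrow> (nat \<Rightarrow> real^'n^'n) \<Rightarrow> real^'n^'n" where
  "mat_prod 0 A = mat 1"
| "mat_prod (Suc n) A = mat_prod n A ** A n"

text \<open>
  The push-forward is a Borel measure on the whole matrix space. This covers both Borel measures
  \<open>\<mu>\<close> on the whole space and Borel measures \<open>\<mu>\<close> on the unit ball.
\<close>

definition conv_power :: "(real^'n^'n) measure \<Rightarrow> nat \<Rightarrow> (real^'n^'n) measure" where
  "conv_power \<mu> n = distr (\<Pi>\<^sub>M i\<in>{..<n}. \<mu>) borel (mat_prod n)"

definition ext_log :: "ennreal \<Rightarrow> ereal" where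
  "ext_log x = (if x = 0 then -\<infinity> else if x = \<infinity> then \<infinity> else ereal (ln (enn2real x)))"

definition norm_pressure :: "(real^'n^'n) measure \<Rightarrow> real \<Rightarrow> ereal" where
  "norm_pressure \<mu> s =
     lim (\<lambda>n. ereal (1 / real n) * ext_log (\<integral>\<^sup>+A. ennreal (op_norm A powr s) \<partial>conv_power \<mu> n))"

end

theory Submission
  imports Defs
begin

text \<open>
  Write \<open>W\<^sub>n\<close> for the \<open>s\<close>-th moment of the norm under the \<open>n\<close>-th convolution power of \<open>\<mu>\<close>. The sequence
  \<open>W\<^sub>n\<close> is submultiplicative, so the norm pressure is the logarithm of \<open>\<rho> = inf W\<^sub>n\<^sup>1\<^sup>/\<^sup>n\<close>, and it is enough
  to prove that \<open>\<rho>\<close> is a continuous real function of \<open>(\<mu>, s)\<close>. Every \<open>W\<^sub>n\<close> is jointly continuous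
  (\<open>continuous_map_moment\<close>), which makes \<open>\<rho>\<close> upper semicontinuous.

  Lower semicontinuity rests on the a priori inequality \<open>moment_rate_lower_bound\<close>: whenever
  \<open>W\<^sub>n > 0\<close>,
    \<open>W\<^sub>n * (W\<^sub>d\<^sub>n / W\<^sub>n ^ d) powr (a * b) \<le> D powr a * \<rho> ^ n\<close>,
  where \<open>a = max 1 (s / 2)\<close>, \<open>b = max 1 (2 / s)\<close> and \<open>D = d ^ (2 * d + 2)\<close>. The left-hand side is continuous
  in \<open>(\<mu>, s)\<close>, and its \<open>n\<close>-th root converges to \<open>\<rho>\<close> if \<open>\<rho> > 0\<close>, because \<open>W\<^sub>d\<^sub>n\<close> and \<open>W\<^sub>n ^ d\<close> both grow like
  \<open>\<rho> ^ (d * n)\<close>. Hence \<open>\<rho>\<close> is, near a point where it is positive, bounded below by continuous functions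
  whose values at that point come arbitrarily close to \<open>\<rho>\<close>.

  To prove the inequality, weight the \<open>n\<close>-th convolution power by the \<open>s\<close>-th power of the norm and push
  it forward under \<open>A \<mapsto> A / \<parallel>A\<parallel>\<close>. This gives a law \<open>\<pi>\<close> on the unit ball with
  \<open>W\<^sub>k\<^sub>n = W\<^sub>n ^ k * (s-th moment of \<pi>\<^sub>k)\<close>. Jensen's inequality trades the exponent \<open>s\<close> for the exponent \<open>2\<close>
  in both directions, at the price of the powers \<open>a\<close> and \<open>b\<close>. What remains is \<open>second_moment_bound\<close>: if
  the second moments of the products of \<open>k\<close> independent \<open>\<pi>\<close>-distributed matrices are \<open>O(r ^ k)\<close>, then
  already the second moment for \<open>k = d\<close> is at most \<open>D * r\<close>.

  For that, consider the linear map which sends a quadratic form \<open>Q\<close> to the mean of \<open>Q (B v)\<close>. For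
  \<open>l > r\<close> a partial sum of its resolvent series, applied to the Euclidean form, is a positive definite
  form \<open>Q\<close> with \<open>E (Q (B v)) \<le> l * Q v\<close>. In an orthonormal basis that diagonalises \<open>Q\<close>, with decreasing
  diagonal, this says that all entries of \<open>B\<close> on and above the diagonal have second moment at most \<open>l\<close>.
  The entries below the diagonal are only known to be at most \<open>1\<close>, but \<open>d\<close> strictly lower triangular
  matrices have product zero, so every term in an entry of a product of \<open>d\<close> factors contains a small
  factor. The shape of \<open>Q\<close>, which can be very eccentric, enters only through the order of the diagonal, and
  this is why the constant depends on \<open>d\<close> alone.
\<close>


section \<open>The operator norm and orthonormal bases\<close>

lemma op_norm_nonneg: "0 \<le> op_norm A"
  by (simp add: op_norm_def onorm_pos_le)

lemma norm_matrix_vector_le: "norm (A *v v) \<le> op_norm A * norm v"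
  by (simp add: op_norm_def onorm)

lemma norm_matrix_vector_le_unit: "op_norm A \<le> 1 \<Longrightarrow> norm (A *v v) \<le> norm v"
  using norm_matrix_vector_le[of A v] mult_right_mono[of "op_norm A" 1 "norm v"] by simp

lemma op_norm_mult: "op_norm (A ** B) \<le> op_norm A * op_norm B"
proof -
  have "onorm (\<lambda>v. A *v (B *v v)) \<le> op_norm A * op_norm B"
    using onorm_compose[of "(*v) A" "(*v) B"] by (simp add: op_norm_def comp_def)
  then show ?thesis
    by (simp add: op_norm_def matrix_vector_mul_assoc)
qed

lemma op_norm_mat_1: "op_norm (mat 1) = 1"
  by (simp add: op_norm_def onorm_id)

lemma op_norm_scaleR: "op_norm (c *\<^sub>R A) = \<bar>c\<bar> * op_norm A"
  by (simp add: op_norm_def onorm_scaleR flip: scaleR_matrix_vector_assoc)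

lemma op_norm_eq_0_iff: "op_norm A = 0 \<longleftrightarrow> A = 0"
  by (simp add: op_norm_def onorm_eq_0 matrix_eq)

lemma op_norm_triangle: "op_norm (A + B) \<le> op_norm A + op_norm B"
  by (simp add: op_norm_def matrix_vector_mult_add_rdistrib onorm_triangle)

text \<open>
  A convex function on a finite-dimensional space is continuous.
\<close>

lemma continuous_op_norm: "continuous_on S op_norm"
proof -
  have "convex_on UNIV (op_norm :: real^'n^'n \<Rightarrow> real)"
  proof (rule convex_onI)
    fix t :: real and A B :: "real^'n^'n" assume "0 < t" "t < 1"
    then show "op_norm ((1 - t) *\<^sub>R A + t *\<^sub>R B) \<le> (1 - t) * op_norm A + t * op_norm B"
      using op_norm_triangle[of "(1 - t) *\<^sub>R A" "t *\<^sub>R B"] by (simp add: op_norm_scaleR)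
  qed auto
  then have "continuous_on UNIV (op_norm :: real^'n^'n \<Rightarrow> real)"
    by (intro convex_on_continuous) auto
  then show ?thesis
    by (rule continuous_on_subset) simp
qed

lemma compact_op_unit_ball: "compact (op_unit_ball :: (real^'n^'n) set)"
proof -
  have "norm A \<le> real CARD('n) * (real CARD('n) * op_norm A)" for A :: "real^'n^'n"
  proof -
    have "norm A \<le> (\<Sum>i\<in>UNIV. norm (A $ i))"
      by (simp add: norm_vec_def L2_set_le_sum)
    also have "\<dots> \<le> (\<Sum>i\<in>(UNIV::'n set). \<Sum>j\<in>(UNIV::'n set). \<bar>A $ i $ j\<bar>)"
      by (intro sum_mono norm_le_l1_cart)
    also have "\<dots> \<le> (\<Sum>i\<in>(UNIV::'n set). \<Sum>j\<in>(UNIV::'n set). op_norm A)"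
      unfolding op_norm_def by (intro sum_mono matrix_component_le_onorm)
    finally show ?thesis by simp
  qed
  moreover have "op_norm A \<le> 1 \<Longrightarrow> real CARD('n) * (real CARD('n) * op_norm A) \<le> real CARD('n) * (real CARD('n) * 1)"
      for A :: "real^'n^'n"
    by (intro mult_left_mono) auto
  ultimately have "norm A \<le> real CARD('n) * (real CARD('n) * 1)" if "A \<in> op_unit_ball" for A :: "real^'n^'n"
    using that unfolding op_unit_ball_def by (metis mem_Collect_eq order_trans)
  then have "bounded (op_unit_ball :: (real^'n^'n) set)"
    unfolding bounded_iff by blast
  moreover have "closed (op_unit_ball :: (real^'n^'n) set)"
    unfolding op_unit_ball_def by (intro closed_Collect_le continuous_op_norm continuous_intros)
  ultimately show ?thesis
    by (simp add: compact_eq_bounded_closed)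
qed

lemma continuous_on_matrix_mult [continuous_intros]:
  fixes f g :: "'a::topological_space \<Rightarrow> real^'n^'n"
  assumes "continuous_on S f" "continuous_on S g"
  shows "continuous_on S (\<lambda>x. f x ** g x)"
  unfolding matrix_matrix_mult_def
  by (intro continuous_on_vec_lambda continuous_intros continuous_on_component assms)

lemma continuous_on_matrix_vector_mult [continuous_intros]:
  fixes f :: "'a::topological_space \<Rightarrow> real^'n^'n"
  assumes "continuous_on S f"
  shows "continuous_on S (\<lambda>x. f x *v v)"
  unfolding matrix_vector_mult_def
  by (intro continuous_on_vec_lambda continuous_intros continuous_on_component assms)

lemma borel_measurable_op_norm [measurable]: "op_norm \<in> borel_measurable borel"
  by (intro borel_measurable_continuous_onI continuous_op_norm)

lemma measurable_matrix_mult [measurable (raw)]: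
  fixes f g :: "'a \<Rightarrow> real^'n^'n"
  assumes "f \<in> borel_measurable M" "g \<in> borel_measurable M"
  shows "(\<lambda>x. f x ** g x) \<in> borel_measurable M"
  using assms by (rule borel_measurable_continuous_Pair) (intro continuous_intros)

lemma measurable_matrix_vector_mult [measurable (raw)]:
  fixes f :: "'a \<Rightarrow> real^'n^'n"
  assumes "f \<in> borel_measurable M"
  shows "(\<lambda>x. f x *v v) \<in> borel_measurable M"
proof -
  have "(\<lambda>A::real^'n^'n. A *v v) \<in> borel_measurable borel"
    by (intro borel_measurable_continuous_onI continuous_intros)
  then show ?thesis using assms by (rule measurable_compose[rotated])
qed

text \<open>
  The spectral theorem for symmetric bilinear forms, with ordered diagonal. Maximising \<open>b x x\<close> over the
  unit sphere of \<open>S\<close> gives the first basis vector \<open>u\<close>; the first-order condition at the maximum makes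
  the orthogonal complement of \<open>u\<close> also \<open>b\<close>-orthogonal to \<open>u\<close>, and the induction continues there.
\<close>

lemma orthonormal_diagonalization:
  fixes b :: "'a::euclidean_space \<Rightarrow> 'a \<Rightarrow> real"
  assumes b: "bilinear b" and sym: "\<And>x y. b x y = b y x"
    and S: "subspace S"
  shows "\<exists>e::nat \<Rightarrow> 'a. (\<forall>i<dim S. e i \<in> S) \<and>
           (\<forall>i<dim S. \<forall>j<dim S. e i \<bullet> e j = (if i = j then 1 else 0)) \<and>
           (\<forall>i<dim S. \<forall>j<dim S. i \<noteq> j \<longrightarrow> b (e i) (e j) = 0) \<and>
           (\<forall>j<dim S. \<forall>i\<le>j. b (e j) (e j) \<le> b (e i) (e i))"
  using S
proof (induction "dim S" arbitrary: S)
  case 0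
  then have "dim S = 0" by simp
  then show ?case by (simp only:) simp
next
  case (Suc m)
  note bl = bilinear_ladd[OF b] bilinear_radd[OF b] bilinear_lmul[OF b] bilinear_rmul[OF b]
  have cont: "continuous_on T (\<lambda>x. b x x)" for T
    using bilinear_continuous_on_compose[OF continuous_on_id continuous_on_id b] by simp
  have ne: "S \<inter> sphere 0 1 \<noteq> {}"
  proof -
    have "\<not> S \<subseteq> {0}" using Suc.hyps(2) by (metis dim_eq_0 nat.distinct(1))
    then obtain x where x: "x \<in> S" "x \<noteq> 0" by blast
    then have "x /\<^sub>R norm x \<in> S \<inter> sphere 0 1"
      using Suc.prems by (auto simp: subspace_scale)
    then show ?thesis by blast
  qed
  have "compact (S \<inter> sphere 0 1)"
    using Suc.prems by (simp add: closed_subspace closed_Int_compact)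
  from continuous_attains_sup[OF this ne cont]
  obtain u where u: "u \<in> S" "norm u = 1"
    and umax: "\<And>x. x \<in> S \<Longrightarrow> norm x = 1 \<Longrightarrow> b x x \<le> b u u"
    by auto
  have umax': "b x x \<le> b u u * (norm x)\<^sup>2" if "x \<in> S" for x
  proof (cases "x = 0")
    case True
    then show ?thesis using bilinear_lzero[OF b] by simp
  next
    case False
    then have "b (x /\<^sub>R norm x) (x /\<^sub>R norm x) \<le> b u u"
      using that Suc.prems by (intro umax) (auto simp: subspace_scale)
    then have "b x x / (norm x * norm x) \<le> b u u"
      by (simp add: bl divide_simps)
    then show ?thesis
      using False by (simp add: divide_simps power2_eq_square mult.commute)
  qed
  have orth: "b u x = 0" if "x \<in> S" "x \<bullet> u = 0" for x
  proof (rule ccontr)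
    assume nz: "b u x \<noteq> 0"
    define c where "c = \<bar>b u u\<bar> * (norm x)\<^sup>2 + \<bar>b x x\<bar> + 1"
    have c: "c > 0" by (simp add: c_def add_nonneg_pos)
    (* The perturbation u + t x with a small t of the sign of b u x would beat the maximum at u. *)
    define t where "t = b u x / c"
    have "b (u + t *\<^sub>R x) (u + t *\<^sub>R x) \<le> b u u * (norm (u + t *\<^sub>R x))\<^sup>2"
      using u that Suc.prems by (intro umax') (auto simp: subspace_add subspace_scale)
    also have "(norm (u + t *\<^sub>R x))\<^sup>2 = 1 + t\<^sup>2 * (norm x)\<^sup>2"
    proof -
      have "u \<bullet> u = 1" "u \<bullet> x = 0"
        using u that by (auto simp: norm_eq_1 inner_commute)
      then show ?thesis
        using that(2) unfolding power2_norm_eq_inner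
        by (simp add: inner_simps power2_eq_square[of t])
    qed
    finally have "2 * t * b u x \<le> t\<^sup>2 * (b u u * (norm x)\<^sup>2 - b x x)"
      by (simp add: bl sym[of x u] algebra_simps power2_eq_square)
    also have "b u u * (norm x)\<^sup>2 \<le> \<bar>b u u\<bar> * (norm x)\<^sup>2"
      by (intro mult_right_mono) auto
    then have "t\<^sup>2 * (b u u * (norm x)\<^sup>2 - b x x) \<le> t\<^sup>2 * c"
      unfolding c_def by (intro mult_left_mono) auto
    finally have "2 * (b u x)\<^sup>2 / c \<le> (b u x)\<^sup>2 / c"
      using c by (simp add: t_def power2_eq_square)
    then show False using nz c by (simp add: divide_simps)
  qed
  define T where "T = {x \<in> S. x \<bullet> u = 0}"
  have subT: "subspace T"
    using Suc.prems unfolding T_def subspace_def by (auto simp: inner_simps)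
  have dimT: "dim T = m"
  proof -
    have "dim {y \<in> S. \<forall>x \<in> span {u}. orthogonal x y} + dim (span {u}) = dim S"
      using u Suc.prems by (intro dim_subspace_orthogonal_to_vectors) (auto simp: span_minimal)
    moreover have "{y \<in> S. \<forall>x \<in> span {u}. orthogonal x y} = T"
      unfolding T_def orthogonal_def span_singleton by (auto simp: inner_commute)
    moreover have "dim (span {u}) = 1"
      using u by (auto simp: dim_singleton)
    ultimately show ?thesis using Suc.hyps(2) by simp
  qed
  obtain e where "(\<forall>i<m. e i \<in> T) \<and>
      (\<forall>i<m. \<forall>j<m. e i \<bullet> e j = (if i = j then 1 else 0)) \<and>
      (\<forall>i<m. \<forall>j<m. i \<noteq> j \<longrightarrow> b (e i) (e j) = 0) \<and>
      (\<forall>j<m. \<forall>i\<le>j. b (e j) (e j) \<le> b (e i) (e i))"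
    using Suc.hyps(1)[OF dimT[symmetric] subT] unfolding dimT by (elim exE)
  then have e: "\<And>i. i < m \<Longrightarrow> e i \<in> T"
      "\<And>i j. i < m \<Longrightarrow> j < m \<Longrightarrow> e i \<bullet> e j = (if i = j then 1 else 0)"
      "\<And>i j. i < m \<Longrightarrow> j < m \<Longrightarrow> i \<noteq> j \<Longrightarrow> b (e i) (e j) = 0"
      "\<And>i j. j < m \<Longrightarrow> i \<le> j \<Longrightarrow> b (e j) (e j) \<le> b (e i) (e i)"
    by simp_all
  have eT: "e i \<in> S" "e i \<bullet> u = 0" "u \<bullet> e i = 0" "norm (e i) = 1" "b u (e i) = 0" "b (e i) u = 0"
      if "i < m" for i
  proof -
    show i: "e i \<in> S" "e i \<bullet> u = 0" "norm (e i) = 1"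
      using e(1)[OF that] e(2)[OF that that] by (auto simp: T_def norm_eq_1)
    then show "u \<bullet> e i = 0" "b u (e i) = 0"
      using orth by (auto simp: inner_commute)
    then show "b (e i) u = 0" by (metis sym)
  qed
  define e' where "e' = case_nat u e"
  have [simp]: "e' 0 = u" "e' (Suc i) = e i" for i by (simp_all add: e'_def)
  have m: "dim S = Suc m" using Suc.hyps by simp
  have "e' i \<in> S" if "i < Suc m" for i
    using that u eT(1) by (cases i) simp_all
  moreover have "e' i \<bullet> e' j = (if i = j then 1 else 0)" if "i < Suc m" "j < Suc m" for i j
    using that u eT(2,3) e(2) by (cases i; cases j) (simp_all add: norm_eq_1)
  moreover have "b (e' i) (e' j) = 0" if "i < Suc m" "j < Suc m" "i \<noteq> j" for i j
    using that eT(5,6) e(3) by (cases i; cases j) simp_all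
  moreover have "b (e' j) (e' j) \<le> b (e' i) (e' i)" if "j < Suc m" "i \<le> j" for i j
    using that umax[OF eT(1,4)] e(4) by (cases i; cases j) simp_all
  ultimately show ?case unfolding m by (intro exI[of _ e'] conjI allI impI) simp_all
qed

lemma orthonormal_expansion:
  fixes e :: "nat \<Rightarrow> 'a::euclidean_space"
  assumes e: "\<And>i j. i < DIM('a) \<Longrightarrow> j < DIM('a) \<Longrightarrow> e i \<bullet> e j = (if i = j then 1 else 0)"
  shows "x = (\<Sum>i<DIM('a). (x \<bullet> e i) *\<^sub>R e i)"
proof -
  let ?d = "DIM('a)" let ?B = "e ` {..<?d}"
  have inj: "inj_on e {..<?d}"
    using e by (intro inj_onI) (metis lessThan_iff zero_neq_one)
  have "pairwise orthogonal ?B"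
    using e by (auto simp: pairwise_def orthogonal_def)
  moreover have "0 \<notin> ?B"
    using e by (metis (no_types, lifting) imageE inner_zero_left lessThan_iff zero_neq_one)
  ultimately have "independent ?B"
    by (rule pairwise_orthogonal_independent)
  then have "UNIV \<subseteq> span ?B"
    by (intro card_ge_dim_independent) (auto simp: card_image[OF inj])
  define y where "y = x - (\<Sum>i<?d. (x \<bullet> e i) *\<^sub>R e i)"
  have "y \<bullet> e j = 0" if "j < ?d" for j
  proof -
    have "(\<Sum>i<?d. (x \<bullet> e i) * (e i \<bullet> e j)) = (\<Sum>i<?d. if i = j then x \<bullet> e j else 0)"
      using that e by (intro sum.cong) auto
    then show ?thesis
      using that by (simp add: y_def inner_diff_left inner_sum_left)
  qed
  then have "orthogonal y z" if "z \<in> span ?B" for z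
    using that by (intro orthogonal_to_span[of z ?B]) (auto simp: orthogonal_def)
  then have "orthogonal y y" using \<open>UNIV \<subseteq> span ?B\<close> by blast
  then show ?thesis by (simp add: orthogonal_self y_def)
qed

lemma orthonormal_parseval:
  fixes e :: "nat \<Rightarrow> 'a::euclidean_space"
  assumes e: "\<And>i j. i < DIM('a) \<Longrightarrow> j < DIM('a) \<Longrightarrow> e i \<bullet> e j = (if i = j then 1 else 0)"
  shows "x \<bullet> y = (\<Sum>i<DIM('a). (x \<bullet> e i) * (e i \<bullet> y))"
  by (subst orthonormal_expansion[OF e, of x]) (simp_all add: inner_sum_left)

text \<open>
  The operator norm is at most the Frobenius norm, which can be computed in any orthonormal basis.
\<close>

lemma op_norm_le_entries:
  fixes e :: "nat \<Rightarrow> real^'n" and A :: "real^'n^'n"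
  assumes e: "\<And>i j. i < CARD('n) \<Longrightarrow> j < CARD('n) \<Longrightarrow> e i \<bullet> e j = (if i = j then 1 else 0)"
  shows "(op_norm A)\<^sup>2 \<le> (\<Sum>i<CARD('n). \<Sum>j<CARD('n). (e i \<bullet> (A *v e j))\<^sup>2)" (is "_ \<le> ?S")
proof -
  have e': "\<And>i j. i < DIM(real^'n) \<Longrightarrow> j < DIM(real^'n) \<Longrightarrow> e i \<bullet> e j = (if i = j then 1 else 0)"
    using e by simp
  have S: "0 \<le> ?S" by (intro sum_nonneg) simp
  have "norm (A *v v) \<le> sqrt ?S * norm v" for v
  proof -
    have "e i \<bullet> (A *v v) = (\<Sum>j<CARD('n). (v \<bullet> e j) * (e i \<bullet> (A *v e j)))" for i
      by (subst orthonormal_expansion[OF e', of v])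
        (simp_all add: linear_sum[OF matrix_vector_mul_linear] inner_sum_right matrix_vector_mult_scaleR)
    then have "(e i \<bullet> (A *v v))\<^sup>2 \<le> (\<Sum>j<CARD('n). (v \<bullet> e j)\<^sup>2) * (\<Sum>j<CARD('n). (e i \<bullet> (A *v e j))\<^sup>2)" for i
      by (simp add: Cauchy_Schwarz_ineq_sum)
    moreover have "(\<Sum>j<CARD('n). (v \<bullet> e j)\<^sup>2) = v \<bullet> v"
      using orthonormal_parseval[OF e', of v v] by (simp add: power2_eq_square inner_commute)
    ultimately have "(\<Sum>i<CARD('n). (e i \<bullet> (A *v v))\<^sup>2) \<le> (v \<bullet> v) * ?S"
      unfolding sum_distrib_left by (intro sum_mono) (simp add: sum_distrib_left)
    moreover have "(\<Sum>i<CARD('n). (e i \<bullet> (A *v v))\<^sup>2) = (norm (A *v v))\<^sup>2"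
      using orthonormal_parseval[OF e', of "A *v v" "A *v v"]
      unfolding power2_norm_eq_inner by (simp add: power2_eq_square inner_commute)
    ultimately have "(norm (A *v v))\<^sup>2 \<le> (sqrt ?S * norm v)\<^sup>2"
      using S by (simp add: power_mult_distrib power2_norm_eq_inner[of v] mult.commute)
    then show ?thesis
      by (rule power2_le_imp_le) (simp add: S)
  qed
  then have "op_norm A \<le> sqrt ?S"
    unfolding op_norm_def by (intro onorm_le)
  then have "(op_norm A)\<^sup>2 \<le> (sqrt ?S)\<^sup>2"
    by (intro power_mono op_norm_nonneg)
  then show ?thesis using S by simp
qed


section \<open>Convolution powers of contractive laws\<close>

text \<open>
  The \<open>\<sigma>\<close>-algebra is left open, so that the predicate covers the measures on the unit ball as well
  as the convolution powers and normalised laws below, which live on the whole matrix space.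
\<close>

definition contractive_law :: "(real^'n^'n) measure \<Rightarrow> bool" where
  "contractive_law \<mu> \<longleftrightarrow>
     prob_space \<mu> \<and> (\<lambda>A. A) \<in> borel_measurable \<mu> \<and> (AE A in \<mu>. op_norm A \<le> 1)"

lemma contractive_lawD:
  assumes "contractive_law \<mu>"
  shows "prob_space \<mu>" "(\<lambda>A. A) \<in> borel_measurable \<mu>" "AE A in \<mu>. op_norm A \<le> 1"
  using assms by (auto simp: contractive_law_def)

lemma contractive_law_ball_prob_measures:
  assumes "\<mu> \<in> ball_prob_measures"
  shows "contractive_law \<mu>"
proof -
  have s: "sets \<mu> = sets (restrict_space borel op_unit_ball)" and p: "prob_space \<mu>"
    using assms by (auto simp: ball_prob_measures_def)
  have "space \<mu> = op_unit_ball"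
    using sets_eq_imp_space_eq[OF s] by (simp add: space_restrict_space)
  then have "AE A in \<mu>. op_norm A \<le> 1"
    by (intro AE_I2) (simp add: op_unit_ball_def)
  moreover have "(\<lambda>A. A) \<in> borel_measurable \<mu>"
    unfolding measurable_cong_sets[OF s refl] by (rule measurable_restrict_space1) simp
  ultimately show ?thesis using p by (simp add: contractive_law_def)
qed

lemma measurable_mat_prod:
  fixes \<mu> :: "(real^'n^'n) measure"
  assumes "(\<lambda>A. A) \<in> borel_measurable \<mu>" "n \<le> m"
  shows "mat_prod n \<in> borel_measurable (\<Pi>\<^sub>M i\<in>{..<m}. \<mu>)"
  using assms(2)
proof (induction n)
  case (Suc n)
  then have "(\<lambda>A. A n) \<in> measurable (\<Pi>\<^sub>M i\<in>{..<m}. \<mu>) \<mu>"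
    by (intro measurable_component_singleton) auto
  from measurable_compose[OF this assms(1)] Suc
  show ?case by (auto simp: mat_prod.simps(2)[abs_def] intro!: measurable_matrix_mult)
qed (simp add: mat_prod.simps(1)[abs_def])

lemma sets_conv_power [simp, measurable_cong]: "sets (conv_power \<mu> n) = sets borel"
  by (simp add: conv_power_def)

lemma prob_space_conv_power:
  assumes "contractive_law \<mu>"
  shows "prob_space (conv_power \<mu> n)"
proof -
  interpret prob_space \<mu> using assms by (rule contractive_lawD)
  interpret P: product_prob_space "\<lambda>_. \<mu>" "{..<n}" ..
  show ?thesis unfolding conv_power_def
    using assms by (intro P.P.prob_space_distr measurable_mat_prod contractive_lawD) auto
qed

lemma mat_prod_upd: "n \<le> i \<Longrightarrow> mat_prod n (A(i := B)) = mat_prod n A"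
  by (induction n) auto

lemma measurable_pair_matrix_mult:
  assumes "contractive_law \<mu>"
  shows "(\<lambda>(A, B). A ** B) \<in> borel_measurable (conv_power \<mu>' n \<Otimes>\<^sub>M \<mu>)"
  unfolding split_beta
proof (rule measurable_matrix_mult)
  show "fst \<in> borel_measurable (conv_power \<mu>' n \<Otimes>\<^sub>M \<mu>)"
    using measurable_fst by (simp cong: measurable_cong_sets)
  show "snd \<in> borel_measurable (conv_power \<mu>' n \<Otimes>\<^sub>M \<mu>)"
    by (rule measurable_compose[OF measurable_snd contractive_lawD(2)[OF assms]])
qed

text \<open>
  Fubini's theorem: the last of the \<open>n + 1\<close> factors is split off. All later recursions over the number
  of factors are read off from this description.
\<close>

lemma conv_power_Suc:
  fixes \<mu> :: "(real^'n^'n) measure"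
  assumes "contractive_law \<mu>"
  shows "conv_power \<mu> (Suc n) = distr (conv_power \<mu> n \<Otimes>\<^sub>M \<mu>) borel (\<lambda>(A, B). A ** B)"
proof (rule measure_eqI)
  interpret prob_space \<mu> using assms by (rule contractive_lawD)
  interpret N: prob_space "conv_power \<mu> n" using assms by (rule prob_space_conv_power)
  interpret P: product_sigma_finite "\<lambda>_. \<mu>" ..
  interpret PP: pair_sigma_finite "conv_power \<mu> n" \<mu> ..
  note [measurable] = contractive_lawD(2)[OF assms]
  note [measurable] = measurable_pair_matrix_mult[OF assms, of \<mu> n]
  fix S assume "S \<in> sets (conv_power \<mu> (Suc n))"
  then have [measurable]: "S \<in> sets borel" by simp
  have [measurable]: "mat_prod n \<in> borel_measurable (\<Pi>\<^sub>M i\<in>{..<n}. \<mu>)"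
    "mat_prod (Suc n) \<in> borel_measurable (\<Pi>\<^sub>M i\<in>insert n {..<n}. \<mu>)"
    using measurable_mat_prod[OF contractive_lawD(2)[OF assms], of n n]
      measurable_mat_prod[OF contractive_lawD(2)[OF assms], of "Suc n" "Suc n"]
    by (simp_all add: lessThan_Suc)
  have meas: "(\<lambda>A. indicator S (mat_prod (Suc n) A) :: ennreal)
      \<in> borel_measurable (\<Pi>\<^sub>M i\<in>insert n {..<n}. \<mu>)"
    by measurable
  have "emeasure (conv_power \<mu> (Suc n)) S
      = (\<integral>\<^sup>+A. indicator S (mat_prod (Suc n) A) \<partial>(\<Pi>\<^sub>M i\<in>insert n {..<n}. \<mu>))"
    by (simp add: conv_power_def lessThan_Suc nn_integral_distr flip: nn_integral_indicator)
  also have "\<dots> = (\<integral>\<^sup>+B. \<integral>\<^sup>+A. indicator S (mat_prod n A ** B) \<partial>(\<Pi>\<^sub>M i\<in>{..<n}. \<mu>) \<partial>\<mu>)"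
    by (subst P.product_nn_integral_insert_rev[OF _ _ meas]) (auto simp: mat_prod_upd)
  also have "\<dots> = (\<integral>\<^sup>+B. \<integral>\<^sup>+A. indicator S (A ** B) \<partial>conv_power \<mu> n \<partial>\<mu>)"
    unfolding conv_power_def
    by (intro nn_integral_cong nn_integral_distr[symmetric]) measurable
  also have "\<dots> = (\<integral>\<^sup>+X. indicator S (case X of (A, B) \<Rightarrow> A ** B) \<partial>(conv_power \<mu> n \<Otimes>\<^sub>M \<mu>))"
    by (subst PP.nn_integral_snd[symmetric]) auto
  also have "\<dots> = emeasure (distr (conv_power \<mu> n \<Otimes>\<^sub>M \<mu>) borel (\<lambda>(A, B). A ** B)) S"
    by (simp add: nn_integral_distr flip: nn_integral_indicator)
  finally show "emeasure (conv_power \<mu> (Suc n)) S =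
      emeasure (distr (conv_power \<mu> n \<Otimes>\<^sub>M \<mu>) borel (\<lambda>(A, B). A ** B)) S" .
qed simp

lemma nn_integral_conv_power_Suc:
  assumes "contractive_law \<mu>" and f: "f \<in> borel_measurable borel"
  shows "(\<integral>\<^sup>+A. f A \<partial>conv_power \<mu> (Suc n)) = (\<integral>\<^sup>+B. \<integral>\<^sup>+A. f (A ** B) \<partial>conv_power \<mu> n \<partial>\<mu>)"
proof -
  interpret prob_space \<mu> using assms(1) by (rule contractive_lawD)
  interpret N: prob_space "conv_power \<mu> n" using assms(1) by (rule prob_space_conv_power)
  interpret PP: pair_sigma_finite "conv_power \<mu> n" \<mu> ..
  note m = measurable_pair_matrix_mult[OF assms(1)]
  show ?thesis
    unfolding conv_power_Suc[OF assms(1)]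
    using PP.nn_integral_snd[OF measurable_compose[OF m f]]
    by (simp add: nn_integral_distr m f)
qed

lemma conv_power_0:
  fixes \<mu> :: "(real^'n^'n) measure"
  shows "conv_power \<mu> 0 = return borel (mat 1)"
proof (rule measure_eqI)
  fix S :: "(real^'n^'n) set" assume "S \<in> sets (conv_power \<mu> 0)"
  then show "emeasure (conv_power \<mu> 0) S = emeasure (return borel (mat 1)) S"
    by (simp add: conv_power_def emeasure_distr mat_prod.simps(1)[abs_def] PiM_empty indicator_def)
qed simp

lemma nn_integral_conv_power_0:
  assumes "f \<in> borel_measurable borel"
  shows "(\<integral>\<^sup>+A. f A \<partial>conv_power \<mu> 0) = f (mat 1)"
  using assms by (simp add: conv_power_0 nn_integral_return)

lemma integral_conv_power_0:
  fixes f :: "real^'n^'n \<Rightarrow> real"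
  assumes "f \<in> borel_measurable borel"
  shows "(\<integral>A. f A \<partial>conv_power \<mu> 0) = f (mat 1)"
  using assms by (simp add: conv_power_0 integral_return)

lemma contractive_law_conv_power:
  assumes "contractive_law \<mu>"
  shows "contractive_law (conv_power \<mu> n)"
proof -
  interpret prob_space \<mu> using assms by (rule contractive_lawD)
  have "(\<integral>\<^sup>+A. indicator {A. 1 < op_norm A} A \<partial>conv_power \<mu> n) = 0"
  proof (induction n)
    case 0
    show ?case
      by (subst nn_integral_conv_power_0) (auto simp: op_norm_mat_1)
  next
    case (Suc n)
    have [measurable]: "{A :: real^'b^'b. 1 < op_norm A} \<in> sets borel" by measurable
    then have "AE A in conv_power \<mu> n. (indicator {A. 1 < op_norm A} A :: ennreal) = 0"
      using Suc by (subst nn_integral_0_iff_AE[symmetric]) (auto)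
    then have A: "AE A in conv_power \<mu> n. op_norm A \<le> 1"
      by (simp add: indicator_def not_less)
    have "(\<integral>\<^sup>+A. indicator {A. 1 < op_norm A} (A ** B) \<partial>conv_power \<mu> n) = 0" if "op_norm B \<le> 1" for B
    proof -
      have "AE A in conv_power \<mu> n. (indicator {A. 1 < op_norm A} (A ** B) :: ennreal) = 0"
        using A
      proof eventually_elim
        case (elim A)
        then have "op_norm A * op_norm B \<le> 1"
          using that op_norm_nonneg by (intro mult_le_one) auto
        then show ?case using op_norm_mult[of A B] by simp
      qed
      then have "(\<integral>\<^sup>+A. indicator {A. 1 < op_norm A} (A ** B) \<partial>conv_power \<mu> n) = (\<integral>\<^sup>+A. 0 \<partial>conv_power \<mu> n)"
        by (rule nn_integral_cong_AE)
      then show ?thesis by simp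
    qed
    then have "AE B in \<mu>. (\<integral>\<^sup>+A. indicator {A. 1 < op_norm A} (A ** B) \<partial>conv_power \<mu> n) = 0"
      using contractive_lawD(3)[OF assms] by auto
    then have "(\<integral>\<^sup>+B. \<integral>\<^sup>+A. indicator {A. 1 < op_norm A} (A ** B) \<partial>conv_power \<mu> n \<partial>\<mu>) = (\<integral>\<^sup>+B. 0 \<partial>\<mu>)"
      by (rule nn_integral_cong_AE)
    then show ?case
      by (subst nn_integral_conv_power_Suc[OF assms]) auto
  qed
  then have "AE A in conv_power \<mu> n. (indicator {A. 1 < op_norm A} A :: ennreal) = 0"
    by (subst nn_integral_0_iff_AE[symmetric]) auto
  then have "AE A in conv_power \<mu> n. op_norm A \<le> 1"
    by (simp add: indicator_def not_less)
  then show ?thesis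
    using prob_space_conv_power[OF assms] by (simp add: contractive_law_def)
qed

lemma integrable_contractive_law:
  fixes f :: "real^'n^'n \<Rightarrow> real"
  assumes "contractive_law \<mu>" and f: "f \<in> borel_measurable borel"
    and K: "\<And>A. op_norm A \<le> 1 \<Longrightarrow> \<bar>f A\<bar> \<le> K"
  shows "integrable \<mu> f"
proof -
  interpret prob_space \<mu> using assms(1) by (rule contractive_lawD)
  show ?thesis
  proof (rule integrable_const_bound)
    show "AE A in \<mu>. norm (f A) \<le> K"
      using contractive_lawD(3)[OF assms(1)] K by auto
    show "f \<in> borel_measurable \<mu>"
      using measurable_compose[OF contractive_lawD(2)[OF assms(1)] f] .
  qed
qed

lemma integral_conv_power_Suc:
  fixes f :: "real^'n^'n \<Rightarrow> real"
  assumes "contractive_law \<mu>" and f: "f \<in> borel_measurable borel"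
    and K: "\<And>A. op_norm A \<le> 1 \<Longrightarrow> \<bar>f A\<bar> \<le> K"
  shows "(\<integral>A. f A \<partial>conv_power \<mu> (Suc n)) = (\<integral>B. (\<integral>A. f (A ** B) \<partial>conv_power \<mu> n) \<partial>\<mu>)"
proof -
  interpret prob_space \<mu> using assms(1) by (rule contractive_lawD)
  interpret N: prob_space "conv_power \<mu> n" using assms(1) by (rule prob_space_conv_power)
  interpret PP: pair_sigma_finite "conv_power \<mu> n" \<mu> ..
  note m = measurable_pair_matrix_mult[OF assms(1)]
  have "integrable (conv_power \<mu> (Suc n)) f"
    by (rule integrable_contractive_law[OF contractive_law_conv_power[OF assms(1)] f K])
  then have "integrable (conv_power \<mu> n \<Otimes>\<^sub>M \<mu>) (\<lambda>(A, B). f (A ** B))"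
    unfolding conv_power_Suc[OF assms(1)]
    using m by (subst (asm) integrable_distr_eq) (auto simp: f split_beta')
  from PP.integral_snd[OF this] show ?thesis
    unfolding conv_power_Suc[OF assms(1)]
    using integral_distr[OF m f] by (simp add: split_beta')
qed

lemma nn_integral_conv_power_add:
  assumes \<mu>: "contractive_law \<mu>" and f: "f \<in> borel_measurable borel"
  shows "(\<integral>\<^sup>+A. f A \<partial>conv_power \<mu> (m + n)) = (\<integral>\<^sup>+B. \<integral>\<^sup>+A. f (A ** B) \<partial>conv_power \<mu> m \<partial>conv_power \<mu> n)"
  using f
proof (induction n arbitrary: f)
  case 0
  interpret N: prob_space "conv_power \<mu> m" using \<mu> by (rule prob_space_conv_power)
  note [measurable] = 0
  have "(\<lambda>B. \<integral>\<^sup>+A. f (A ** B) \<partial>conv_power \<mu> m) \<in> borel_measurable borel"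
    by measurable
  then show ?case by (simp add: nn_integral_conv_power_0)
next
  case (Suc n)
  interpret N: prob_space "conv_power \<mu> m" using \<mu> by (rule prob_space_conv_power)
  note [measurable] = Suc.prems
  have h: "(\<lambda>B. \<integral>\<^sup>+A. f (A ** B) \<partial>conv_power \<mu> m) \<in> borel_measurable borel"
    by measurable
  have "(\<integral>\<^sup>+A. f A \<partial>conv_power \<mu> (m + Suc n)) = (\<integral>\<^sup>+C. \<integral>\<^sup>+A. f (A ** C) \<partial>conv_power \<mu> (m + n) \<partial>\<mu>)"
    using nn_integral_conv_power_Suc[OF \<mu> Suc.prems] by simp
  also have "\<dots> = (\<integral>\<^sup>+C. \<integral>\<^sup>+B. \<integral>\<^sup>+A. f ((A ** B) ** C) \<partial>conv_power \<mu> m \<partial>conv_power \<mu> n \<partial>\<mu>)"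
    by (intro nn_integral_cong Suc.IH) measurable
  also have "\<dots> = (\<integral>\<^sup>+B. \<integral>\<^sup>+A. f (A ** B) \<partial>conv_power \<mu> m \<partial>conv_power \<mu> (Suc n))"
    by (subst nn_integral_conv_power_Suc[OF \<mu> h]) (simp add: matrix_mul_assoc)
  finally show ?case .
qed


section \<open>Second moments of products of independent contractions\<close>

text \<open>
  Let \<open>T\<close> be the map \<open>Q \<mapsto> (v \<mapsto> E (Q (B v)))\<close> on quadratic forms. The form \<open>q k\<close>, the mean of
  \<open>\<parallel>A v\<parallel>\<^sup>2\<close> over products \<open>A\<close> of \<open>k\<close> factors, is the \<open>k\<close>-th iterate of \<open>T\<close> at the Euclidean form.
  The truncated series \<open>\<Sum>k<K. q k / l ^ k\<close> is multiplied by at most \<open>l\<close> under \<open>T\<close>: the boundary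
  term \<open>q K / l ^ K\<close> is below the Euclidean form for large \<open>K\<close>, since \<open>r < l\<close>.
\<close>

lemma contracting_quadratic_form:
  fixes \<pi> :: "(real^'n^'n) measure"
  assumes \<pi>: "contractive_law \<pi>" and r: "0 < r" "r < l"
    and growth: "\<And>k. (\<integral>A. (op_norm A)\<^sup>2 \<partial>conv_power \<pi> k) \<le> C * r ^ k"
  obtains b where "bilinear b" "\<And>u v. b u v = b v u" "\<And>v. (norm v)\<^sup>2 \<le> b v v"
    "\<And>v. integrable \<pi> (\<lambda>A. b (A *v v) (A *v v))"
    "\<And>v. (\<integral>A. b (A *v v) (A *v v) \<partial>\<pi>) \<le> l * b v v"
proof -
  have l: "l > 0" using r by simp
  define q where "q = (\<lambda>k u v. \<integral>A. (A *v u) \<bullet> (A *v v) \<partial>conv_power \<pi> k)"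
  have meas [measurable]: "(\<lambda>A::real^'n^'n. (A *v u) \<bullet> (A *v v)) \<in> borel_measurable borel" for u v
    by measurable
  have bnd: "\<bar>(A *v u) \<bullet> (A *v v)\<bar> \<le> norm u * norm v" if "op_norm A \<le> 1" for A :: "real^'n^'n" and u v
    using order_trans[OF Cauchy_Schwarz_ineq2[of "A *v u" "A *v v"]
        mult_mono[OF norm_matrix_vector_le_unit[OF that] norm_matrix_vector_le_unit[OF that]]] by simp
  have int: "integrable (conv_power \<pi> k) (\<lambda>A. (A *v u) \<bullet> (A *v v))" for k u v
    using contractive_law_conv_power[OF \<pi>] meas bnd by (rule integrable_contractive_law)
  have q_bil: "bilinear (q k)" for k
    unfolding bilinear_def q_def
    by (auto intro!: linearI simp: matrix_vector_right_distrib matrix_vector_mult_scaleR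
        inner_add_left inner_add_right int)
  have q_sym: "q k u v = q k v u" for k u v
    by (simp add: q_def inner_commute)
  have q_nonneg: "0 \<le> q k v v" for k v
    unfolding q_def by (intro integral_nonneg_AE) auto
  have q_0: "q 0 v v = (norm v)\<^sup>2" for v
    by (simp add: q_def integral_conv_power_0 power2_norm_eq_inner)
  have q_le: "q k v v \<le> C * r ^ k * (norm v)\<^sup>2" for k v
  proof -
    have "q k v v \<le> (\<integral>A. (op_norm A)\<^sup>2 * (norm v)\<^sup>2 \<partial>conv_power \<pi> k)"
      unfolding q_def
    proof (rule integral_mono)
      show "integrable (conv_power \<pi> k) (\<lambda>A. (op_norm A)\<^sup>2 * (norm v)\<^sup>2)"
        by (rule integrable_contractive_law[OF contractive_law_conv_power[OF \<pi>], where K = "(norm v)\<^sup>2"])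
          (auto simp: abs_mult op_norm_nonneg power_le_one mult_left_le_one_le)
      show "(A *v v) \<bullet> (A *v v) \<le> (op_norm A)\<^sup>2 * (norm v)\<^sup>2" for A
        using power_mono[OF norm_matrix_vector_le[of A v], of 2]
        by (simp add: power2_norm_eq_inner power_mult_distrib)
    qed (rule int)
    also have "\<dots> \<le> C * r ^ k * (norm v)\<^sup>2"
      using growth[of k] by (simp add: mult_right_mono)
    finally show ?thesis .
  qed
  have q_Suc: "integrable \<pi> (\<lambda>B. q k (B *v v) (B *v v))"
      "(\<integral>B. q k (B *v v) (B *v v) \<partial>\<pi>) = q (Suc k) v v" for k v
  proof -
    interpret N: prob_space "conv_power \<pi> k" using \<pi> by (rule prob_space_conv_power)
    have eq: "(A *v (B *v v)) \<bullet> (A *v (B *v v)) = ((A ** B) *v v) \<bullet> ((A ** B) *v v)" for A B :: "real^'n^'n"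
      by (simp add: matrix_vector_mul_assoc)
    have m: "(\<lambda>B. q k (B *v v) (B *v v)) \<in> borel_measurable borel"
      unfolding q_def eq by measurable
    have "\<bar>q k (B *v v) (B *v v)\<bar> \<le> C * r ^ k * (norm v)\<^sup>2" if "op_norm B \<le> 1" for B
    proof -
      have "0 \<le> (\<integral>A. (op_norm A)\<^sup>2 \<partial>conv_power \<pi> k)" by (intro integral_nonneg_AE) auto
      then have "0 \<le> C * r ^ k" using growth[of k] by linarith
      then have "C * r ^ k * (norm (B *v v))\<^sup>2 \<le> C * r ^ k * (norm v)\<^sup>2"
        using norm_matrix_vector_le_unit[OF that] by (intro mult_left_mono power_mono) auto
      then show ?thesis using q_le[of k "B *v v"] q_nonneg by (simp add: abs_of_nonneg)
    qed
    then show "integrable \<pi> (\<lambda>B. q k (B *v v) (B *v v))"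
      by (rule integrable_contractive_law[OF \<pi> m])
    show "(\<integral>B. q k (B *v v) (B *v v) \<partial>\<pi>) = q (Suc k) v v"
      unfolding q_def eq by (rule integral_conv_power_Suc[OF \<pi> meas bnd, symmetric])
  qed
  have "(\<lambda>k. C * (r / l) ^ k) \<longlonglongrightarrow> C * 0"
    using r by (intro tendsto_intros LIMSEQ_power_zero) auto
  then have "\<forall>\<^sub>F k in sequentially. C * (r / l) ^ k < 1"
    by (intro order_tendstoD(2)) auto
  moreover have "\<forall>\<^sub>F k in sequentially. k \<ge> (1::nat)" by (rule eventually_ge_at_top)
  (* K is positive, so that the Euclidean form itself is one of the summands of b. *)
  ultimately have "\<forall>\<^sub>F k in sequentially. C * (r / l) ^ k < 1 \<and> k \<ge> 1" by eventually_elim simp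
  then obtain K :: nat where K: "C * (r / l) ^ K < 1" "K \<ge> 1"
    by (auto simp: eventually_sequentially)
  define b where "b = (\<lambda>u v. \<Sum>k<K. q k u v / l ^ k)"
  show thesis
  proof
    show "bilinear b"
      using q_bil unfolding b_def bilinear_def
      by (auto simp: linear_iff sum.distrib add_divide_distrib sum_distrib_left)
    show "b u v = b v u" for u v by (simp add: b_def q_sym)
    show "(norm v)\<^sup>2 \<le> b v v" for v
    proof -
      have "(\<Sum>k\<in>{0}. q k v v / l ^ k) \<le> b v v"
        unfolding b_def using K l q_nonneg by (intro sum_mono2) auto
      then show ?thesis by (simp add: q_0)
    qed
    show "integrable \<pi> (\<lambda>A. b (A *v v) (A *v v))" for v
      unfolding b_def by (intro Bochner_Integration.integrable_sum integrable_divide q_Suc)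
    show "(\<integral>A. b (A *v v) (A *v v) \<partial>\<pi>) \<le> l * b v v" for v
    proof -
      have "(\<integral>A. b (A *v v) (A *v v) \<partial>\<pi>) = (\<Sum>k<K. q (Suc k) v v / l ^ k)"
        unfolding b_def by (simp add: Bochner_Integration.integral_sum integrable_divide q_Suc)
      also have "\<dots> = l * (\<Sum>k<K. q (Suc k) v v / l ^ Suc k)"
        using l by (simp add: sum_distrib_left)
      also have "(\<Sum>k<K. q (Suc k) v v / l ^ Suc k) = (\<Sum>k<Suc K. q k v v / l ^ k) - q 0 v v"
        unfolding sum.lessThan_Suc_shift by simp
      also have "\<dots> = b v v + q K v v / l ^ K - (norm v)\<^sup>2"
        by (simp add: b_def q_0)
      also have "q K v v / l ^ K \<le> C * r ^ K * (norm v)\<^sup>2 / l ^ K"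
        using q_le[of K v] l by (simp add: divide_right_mono)
      also have "\<dots> = C * (r / l) ^ K * (norm v)\<^sup>2"
        by (simp add: power_divide)
      also have "\<dots> \<le> 1 * (norm v)\<^sup>2"
        using K by (intro mult_right_mono) auto
      finally show ?thesis using l by simp
    qed
  qed
qed

text \<open>
  Quantitative nilpotency of strictly lower triangular matrices. A nonzero entry \<open>(i, j)\<close> of a product
  of \<open>k\<close> strictly lower triangular matrices needs \<open>i \<ge> j + k\<close>. If the entries on and above the
  diagonal are merely small in mean square, then so are the entries of the product with
  \<open>i < j + k\<close>: each path from \<open>j\<close> to \<open>i\<close> uses at least one small entry, the other entries are bounded
  by \<open>1\<close>, and independence of the factors lets the second moments multiply.
\<close>

lemma entry_second_moment_bound:
  fixes \<pi> :: "(real^'n^'n) measure" and e :: "nat \<Rightarrow> real^'n"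
  assumes \<pi>: "contractive_law \<pi>" and l: "0 \<le> l"
    and e: "\<And>i j. i < CARD('n) \<Longrightarrow> j < CARD('n) \<Longrightarrow> e i \<bullet> e j = (if i = j then 1 else 0)"
    and upper: "\<And>i j. j < CARD('n) \<Longrightarrow> i \<le> j \<Longrightarrow> (\<integral>A. (e i \<bullet> (A *v e j))\<^sup>2 \<partial>\<pi>) \<le> l"
    and ij: "i < CARD('n)" "j < CARD('n)" "i < j + k"
  shows "(\<integral>A. (e i \<bullet> (A *v e j))\<^sup>2 \<partial>conv_power \<pi> k) \<le> real CARD('n) ^ (2 * k) * l"
  using ij
proof (induction k arbitrary: i j)
  case 0
  then show ?case
    using e l by (simp add: integral_conv_power_0)
next
  case (Suc k)
  let ?d = "CARD('n)"
  have e': "\<And>i j. i < DIM(real^'n) \<Longrightarrow> j < DIM(real^'n) \<Longrightarrow> e i \<bullet> e j = (if i = j then 1 else 0)"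
    using e by simp
  interpret P: prob_space \<pi> using \<pi> by (rule contractive_lawD)
  interpret N: prob_space "conv_power \<pi> k" using \<pi> by (rule prob_space_conv_power)
  have ne: "norm (e i) = 1" if "i < ?d" for i
    using e[OF that that] by (simp add: norm_eq_1)
  have bnd: "(e i \<bullet> (A *v e j))\<^sup>2 \<le> 1" if "op_norm A \<le> 1" "i < ?d" "j < ?d" for A i j
  proof -
    have "\<bar>e i \<bullet> (A *v e j)\<bar> \<le> norm (e i) * norm (A *v e j)"
      by (rule Cauchy_Schwarz_ineq2)
    also have "\<dots> \<le> 1" using norm_matrix_vector_le_unit[OF that(1), of "e j"] ne that by simp
    finally show ?thesis by (simp add: abs_square_le_1)
  qed
  have int: "integrable \<mu> (\<lambda>A. (e i \<bullet> (A *v e j))\<^sup>2)" if "contractive_law \<mu>" "i < ?d" "j < ?d" for \<mu> i j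
    using bnd that by (intro integrable_contractive_law[where K = 1]) auto
  have le1: "(\<integral>A. (e i \<bullet> (A *v e j))\<^sup>2 \<partial>\<mu>) \<le> 1" if "contractive_law \<mu>" "i < ?d" "j < ?d" for \<mu> i j
  proof -
    interpret M: prob_space \<mu> using that by (intro contractive_lawD)
    show ?thesis
      using contractive_lawD(3)[OF that(1)] bnd that by (intro M.integral_le_const int) auto
  qed
  have nonneg: "0 \<le> (\<integral>A. (e i \<bullet> (A *v e j))\<^sup>2 \<partial>\<mu>)" for \<mu> i j
    by (intro integral_nonneg_AE) auto
  let ?X = "\<lambda>l. \<integral>A. (e i \<bullet> (A *v e l))\<^sup>2 \<partial>conv_power \<pi> k"
  let ?Y = "\<lambda>l. \<integral>B. (e l \<bullet> (B *v e j))\<^sup>2 \<partial>\<pi>"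
  have XY: "?X m * ?Y m \<le> real ?d ^ (2 * k) * l" if m: "m < ?d" for m
  (* The last factor takes j to m. If m > j, then i < m + k, and the other k factors contribute a small entry. *)
  proof (cases "m \<le> j")
    case True
    have "?X m * ?Y m \<le> 1 * l"
      using upper[OF Suc.prems(2) True] nonneg le1[OF contractive_law_conv_power[OF \<pi>] Suc.prems(1) m]
      by (intro mult_mono) auto
    also have "\<dots> \<le> real ?d ^ (2 * k) * l"
      using l by (intro mult_right_mono) (auto simp: one_le_power)
    finally show ?thesis .
  next
    case False
    then have "?X m \<le> real ?d ^ (2 * k) * l"
      using Suc.prems m by (intro Suc.IH) auto
    then have "?X m * ?Y m \<le> (real ?d ^ (2 * k) * l) * 1"
      using nonneg le1[OF \<pi> m Suc.prems(2)] l by (intro mult_mono) auto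
    then show ?thesis by simp
  qed
  have sq: "(e i \<bullet> ((A ** B) *v e j))\<^sup>2 \<le> real ?d * (\<Sum>m<?d. (e i \<bullet> (A *v e m))\<^sup>2 * (e m \<bullet> (B *v e j))\<^sup>2)" for A B
  proof -
    have "e i \<bullet> ((A ** B) *v e j) = (\<Sum>m<?d. (e i \<bullet> (A *v e m)) * (e m \<bullet> (B *v e j)))"
    proof -
      have "e i \<bullet> ((A ** B) *v e j) = e i \<bullet> (A *v (B *v e j))"
        by (simp add: matrix_vector_mul_assoc)
      also have "\<dots> = (\<Sum>m<?d. (e i \<bullet> (A *v e m)) * (e m \<bullet> (B *v e j)))"
        by (subst orthonormal_expansion[OF e', of "B *v e j"])
          (simp_all add: linear_sum[OF matrix_vector_mul_linear] inner_sum_right matrix_vector_mult_scaleR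
            inner_commute mult.commute)
      finally show ?thesis .
    qed
    then show ?thesis
      using sum_squared_le_sum_of_squares[of "\<lambda>m. (e i \<bullet> (A *v e m)) * (e m \<bullet> (B *v e j))" "{..<?d}"]
      by (simp add: power_mult_distrib mult.commute)
  qed
  have "(\<integral>A. (e i \<bullet> (A *v e j))\<^sup>2 \<partial>conv_power \<pi> (Suc k))
      = (\<integral>B. (\<integral>A. (e i \<bullet> ((A ** B) *v e j))\<^sup>2 \<partial>conv_power \<pi> k) \<partial>\<pi>)"
    using bnd Suc.prems by (intro integral_conv_power_Suc[OF \<pi>, where K = 1]) auto
  also have "\<dots> \<le> (\<integral>B. real ?d * (\<Sum>m<?d. ?X m * (e m \<bullet> (B *v e j))\<^sup>2) \<partial>\<pi>)"
  proof (rule integral_mono_AE)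
    have inner: "integrable (conv_power \<pi> k)
        (\<lambda>A. real ?d * (\<Sum>m<?d. (e i \<bullet> (A *v e m))\<^sup>2 * (e m \<bullet> (B *v e j))\<^sup>2))" for B
      using Suc.prems by (intro integrable_mult_right Bochner_Integration.integrable_sum
          integrable_mult_left int contractive_law_conv_power \<pi>) auto
    have le: "(\<integral>A. (e i \<bullet> ((A ** B) *v e j))\<^sup>2 \<partial>conv_power \<pi> k)
        \<le> real ?d * (\<Sum>m<?d. ?X m * (e m \<bullet> (B *v e j))\<^sup>2)" for B
    proof -
      have "(\<integral>A. (e i \<bullet> ((A ** B) *v e j))\<^sup>2 \<partial>conv_power \<pi> k)
          \<le> (\<integral>A. real ?d * (\<Sum>m<?d. (e i \<bullet> (A *v e m))\<^sup>2 * (e m \<bullet> (B *v e j))\<^sup>2) \<partial>conv_power \<pi> k)"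
        by (intro integral_mono' inner sq mult_nonneg_nonneg sum_nonneg) auto
      also have "\<dots> = real ?d * (\<Sum>m<?d. ?X m * (e m \<bullet> (B *v e j))\<^sup>2)"
        using Suc.prems by (subst integral_mult_right_zero)
          (auto simp: Bochner_Integration.integral_sum int contractive_law_conv_power \<pi>
            intro!: sum.cong)
      finally show ?thesis .
    qed
    show "integrable \<pi> (\<lambda>B. real ?d * (\<Sum>m<?d. ?X m * (e m \<bullet> (B *v e j))\<^sup>2))"
      using Suc.prems by (intro integrable_mult_right Bochner_Integration.integrable_sum int \<pi>) auto
    then show "integrable \<pi> (\<lambda>B. \<integral>A. (e i \<bullet> ((A ** B) *v e j))\<^sup>2 \<partial>conv_power \<pi> k)"
    proof (rule Bochner_Integration.integrable_bound)
      note [measurable] = contractive_lawD(2)[OF \<pi>]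
      show "(\<lambda>B. \<integral>A. (e i \<bullet> ((A ** B) *v e j))\<^sup>2 \<partial>conv_power \<pi> k) \<in> borel_measurable \<pi>"
      proof -
        have "(\<lambda>B. \<integral>A. (e i \<bullet> ((A ** B) *v e j))\<^sup>2 \<partial>conv_power \<pi> k) \<in> borel_measurable borel"
          by measurable
        from measurable_compose[OF contractive_lawD(2)[OF \<pi>] this] show ?thesis .
      qed
      have "0 \<le> (\<integral>A. (e i \<bullet> ((A ** B) *v e j))\<^sup>2 \<partial>conv_power \<pi> k)" for B
        by (intro integral_nonneg_AE) auto
      then show "AE B in \<pi>. norm (\<integral>A. (e i \<bullet> ((A ** B) *v e j))\<^sup>2 \<partial>conv_power \<pi> k)
          \<le> norm (real ?d * (\<Sum>m<?d. ?X m * (e m \<bullet> (B *v e j))\<^sup>2))"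
        using le by (intro AE_I2) (smt (verit) real_norm_def)
    qed
    show "AE B in \<pi>. (\<integral>A. (e i \<bullet> ((A ** B) *v e j))\<^sup>2 \<partial>conv_power \<pi> k)
        \<le> real ?d * (\<Sum>m<?d. ?X m * (e m \<bullet> (B *v e j))\<^sup>2)"
      using le by simp
  qed
  also have "\<dots> = real ?d * (\<Sum>m<?d. ?X m * ?Y m)"
    using Suc.prems by (simp add: Bochner_Integration.integral_sum int \<pi>)
  also have "\<dots> \<le> real ?d * (\<Sum>m<?d. real ?d ^ (2 * k) * l)"
    using XY by (intro mult_left_mono sum_mono) auto
  also have "\<dots> = real ?d ^ (2 * Suc k) * l"
    by (simp add: power2_eq_square power_add)
  finally show ?case .
qed

text \<open>
  The quadratic form provided by \<open>contracting_quadratic_form\<close> is diagonalised. As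
  \<open>b (e i) (e i) * (e i \<bullet> v)\<^sup>2 \<le> b v v\<close>, its contraction property bounds the mean square of the entry
  \<open>(i, j)\<close> by \<open>l * b (e j) (e j) / b (e i) (e i)\<close>, which is at most \<open>l\<close> for \<open>i \<le> j\<close>. For \<open>d\<close>
  factors the condition \<open>i < j + d\<close> of \<open>entry_second_moment_bound\<close> is met by all entries.
\<close>

lemma second_moment_bound:
  fixes \<pi> :: "(real^'n^'n) measure"
  assumes \<pi>: "contractive_law \<pi>" and r: "0 < r"
    and growth: "\<And>k. (\<integral>A. (op_norm A)\<^sup>2 \<partial>conv_power \<pi> k) \<le> C * r ^ k"
  shows "(\<integral>A. (op_norm A)\<^sup>2 \<partial>conv_power \<pi> CARD('n)) \<le> real CARD('n) ^ (2 * CARD('n) + 2) * r"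
proof -
  let ?d = "CARD('n)" let ?g = "\<integral>A. (op_norm A)\<^sup>2 \<partial>conv_power \<pi> ?d"
  have "?g \<le> real ?d ^ (2 * ?d + 2) * l" if rl: "r < l" for l
  proof -
    obtain b where b: "bilinear b" "\<And>u v. b u v = b v u" "\<And>v. (norm v)\<^sup>2 \<le> b v v"
      and bi: "\<And>v. integrable \<pi> (\<lambda>A. b (A *v v) (A *v v))"
      and bl: "\<And>v. (\<integral>A. b (A *v v) (A *v v) \<partial>\<pi>) \<le> l * b v v"
      using contracting_quadratic_form[OF \<pi> r rl growth] by blast
    obtain e :: "nat \<Rightarrow> real^'n" where
      "(\<forall>i<?d. e i \<in> UNIV) \<and>
       (\<forall>i<?d. \<forall>j<?d. e i \<bullet> e j = (if i = j then 1 else 0)) \<and>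
       (\<forall>i<?d. \<forall>j<?d. i \<noteq> j \<longrightarrow> b (e i) (e j) = 0) \<and>
       (\<forall>j<?d. \<forall>i\<le>j. b (e j) (e j) \<le> b (e i) (e i))"
      using orthonormal_diagonalization[OF b(1,2) subspace_UNIV] unfolding dim_UNIV DIM_cart DIM_real mult_1_right
      by (elim exE)
    then have e: "\<And>i j. i < ?d \<Longrightarrow> j < ?d \<Longrightarrow> e i \<bullet> e j = (if i = j then 1 else 0)"
      and ed: "\<And>i j. i < ?d \<Longrightarrow> j < ?d \<Longrightarrow> i \<noteq> j \<Longrightarrow> b (e i) (e j) = 0"
      and em: "\<And>i j. j < ?d \<Longrightarrow> i \<le> j \<Longrightarrow> b (e j) (e j) \<le> b (e i) (e i)"
      by simp_all
    have e': "\<And>i j. i < DIM(real^'n) \<Longrightarrow> j < DIM(real^'n) \<Longrightarrow> e i \<bullet> e j = (if i = j then 1 else 0)"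
      using e by simp
    have pos: "b (e i) (e i) > 0" if "i < ?d" for i
      using b(3)[of "e i"] e[OF that that] by (simp add: power2_norm_eq_inner)
    have entry: "b (e i) (e i) * (e i \<bullet> v)\<^sup>2 \<le> b v v" if "i < ?d" for i v
    proof -
      have "b v v = b (\<Sum>i<?d. (v \<bullet> e i) *\<^sub>R e i) (\<Sum>i<?d. (v \<bullet> e i) *\<^sub>R e i)"
        using orthonormal_expansion[OF e', of v] by simp
      also have "\<dots> = (\<Sum>(i, j)\<in>{..<?d} \<times> {..<?d}. b ((v \<bullet> e i) *\<^sub>R e i) ((v \<bullet> e j) *\<^sub>R e j))"
        by (rule bilinear_sum[OF b(1)])
      also have "\<dots> = (\<Sum>i<?d. \<Sum>j<?d. if i = j then (v \<bullet> e i)\<^sup>2 * b (e i) (e i) else 0)"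
        unfolding sum.cartesian_product[symmetric] using ed
        by (intro sum.cong) (auto simp: bilinear_lmul[OF b(1)] bilinear_rmul[OF b(1)] power2_eq_square)
      also have "\<dots> = (\<Sum>i<?d. (v \<bullet> e i)\<^sup>2 * b (e i) (e i))" by simp
      also have "\<dots> \<ge> (\<Sum>i\<in>{i}. (v \<bullet> e i)\<^sup>2 * b (e i) (e i))"
        using that pos by (intro sum_mono2 mult_nonneg_nonneg) (auto simp: less_imp_le)
      finally show ?thesis by (simp add: inner_commute mult.commute)
    qed
    have upper: "(\<integral>A. (e i \<bullet> (A *v e j))\<^sup>2 \<partial>\<pi>) \<le> l" if "j < ?d" "i \<le> j" for i j
    proof -
      have i: "i < ?d" using that by simp
      have "b (e i) (e i) * (\<integral>A. (e i \<bullet> (A *v e j))\<^sup>2 \<partial>\<pi>)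
          = (\<integral>A. b (e i) (e i) * (e i \<bullet> (A *v e j))\<^sup>2 \<partial>\<pi>)" by simp
      also have "\<dots> \<le> (\<integral>A. b (A *v e j) (A *v e j) \<partial>\<pi>)"
        using entry[OF i] b(3) by (intro integral_mono' bi) (auto intro: order_trans[OF zero_le_power2])
      also have "\<dots> \<le> l * b (e j) (e j)" by (rule bl)
      also have "\<dots> \<le> l * b (e i) (e i)"
        using em[OF that] r rl by (intro mult_left_mono) auto
      finally show ?thesis using pos[OF i] by (simp add: mult.commute)
    qed
    have int: "integrable (conv_power \<pi> ?d) (\<lambda>A. (e i \<bullet> (A *v e j))\<^sup>2)" if "i < ?d" "j < ?d" for i j
    proof (rule integrable_contractive_law[OF contractive_law_conv_power[OF \<pi>]])
      fix A :: "real^'n^'n" assume A: "op_norm A \<le> 1"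
      have "\<bar>e i \<bullet> (A *v e j)\<bar> \<le> norm (e i) * norm (A *v e j)"
        by (rule Cauchy_Schwarz_ineq2)
      also have "\<dots> \<le> 1"
        using norm_matrix_vector_le_unit[OF A, of "e j"] e that by (simp add: norm_eq_sqrt_inner)
      finally show "\<bar>(e i \<bullet> (A *v e j))\<^sup>2\<bar> \<le> 1" by (simp add: abs_square_le_1)
    qed measurable
    have "?g \<le> (\<integral>A. (\<Sum>i<?d. \<Sum>j<?d. (e i \<bullet> (A *v e j))\<^sup>2) \<partial>conv_power \<pi> ?d)"
      using op_norm_le_entries[OF e] int
      by (intro integral_mono' Bochner_Integration.integrable_sum) (auto intro: order_trans[OF zero_le_power2])
    also have "\<dots> = (\<Sum>i<?d. \<integral>A. (\<Sum>j<?d. (e i \<bullet> (A *v e j))\<^sup>2) \<partial>conv_power \<pi> ?d)"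
      by (rule Bochner_Integration.integral_sum) (auto intro!: Bochner_Integration.integrable_sum int)
    also have "\<dots> = (\<Sum>i<?d. \<Sum>j<?d. \<integral>A. (e i \<bullet> (A *v e j))\<^sup>2 \<partial>conv_power \<pi> ?d)"
      by (intro sum.cong refl Bochner_Integration.integral_sum) (auto intro!: int)
    also have "\<dots> \<le> (\<Sum>i<?d. \<Sum>j<?d. real ?d ^ (2 * ?d) * l)"
      using r rl by (intro sum_mono entry_second_moment_bound[OF \<pi> _ e upper]) auto
    also have "\<dots> = real ?d ^ (2 * ?d + 2) * l"
      by (simp add: power2_eq_square power_add)
    finally show ?thesis .
  qed
  then have "?g / real ?d ^ (2 * ?d + 2) \<le> l" if "r < l" for l
    using that by (simp add: divide_le_eq mult.commute)
  then have "?g / real ?d ^ (2 * ?d + 2) \<le> r"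
    by (rule dense_ge)
  then show ?thesis by (simp add: divide_le_eq mult.commute)
qed


section \<open>Norm moments and their growth\<close>

definition moment :: "(real^'n^'n) measure \<Rightarrow> real \<Rightarrow> real" where
  "moment \<mu> s = (\<integral>A. op_norm A powr s \<partial>\<mu>)"

text \<open>
  The law of \<open>A / \<parallel>A\<parallel>\<close> when \<open>\<mu>\<close> is reweighted by the \<open>s\<close>-th power of the norm. The weight vanishes at
  the zero matrix, so the value of \<open>A / \<parallel>A\<parallel>\<close> there is immaterial. In this form no integrability of
  negative powers of the norm arises when \<open>s < 2\<close>.
\<close>

definition normalized_law :: "(real^'n^'n) measure \<Rightarrow> real \<Rightarrow> (real^'n^'n) measure" where
  "normalized_law \<mu> s =
     distr (density \<mu> (\<lambda>A. ennreal (op_norm A powr s / moment \<mu> s))) borel (\<lambda>A. A /\<^sub>R op_norm A)"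

lemma integrable_op_norm_powr:
  assumes "contractive_law \<mu>" "0 < s"
  shows "integrable \<mu> (\<lambda>A. op_norm A powr s)"
  using assms
  by (intro integrable_contractive_law[where K = 1]) (auto simp: op_norm_nonneg powr_le1)

lemma moment_nonneg: "0 \<le> moment \<mu> s"
  unfolding moment_def by (intro integral_nonneg_AE) auto

lemma moment_antimono:
  assumes "contractive_law \<mu>" "0 < p" "p \<le> q"
  shows "moment \<mu> q \<le> moment \<mu> p"
  unfolding moment_def
proof (rule integral_mono_AE)
  show "AE A in \<mu>. op_norm A powr q \<le> op_norm A powr p"
    using contractive_lawD(3)[OF assms(1)]
  proof eventually_elim
    case (elim A)
    then show ?case
      using assms op_norm_nonneg[of A] by (cases "op_norm A = 0") (auto intro: powr_mono')
  qed
qed (use assms in \<open>auto intro: integrable_op_norm_powr\<close>)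

lemma moment_le_1:
  assumes "contractive_law \<mu>" "0 < s"
  shows "moment \<mu> s \<le> 1"
proof -
  interpret prob_space \<mu> using assms(1) by (rule contractive_lawD)
  show ?thesis
    unfolding moment_def using assms contractive_lawD(3)[OF assms(1)]
    by (intro integral_le_const integrable_op_norm_powr) (auto simp: op_norm_nonneg powr_le1)
qed

lemma nn_integral_moment:
  assumes "contractive_law \<mu>" "0 < s"
  shows "(\<integral>\<^sup>+A. ennreal (op_norm A powr s) \<partial>\<mu>) = ennreal (moment \<mu> s)"
  unfolding moment_def using assms
  by (intro nn_integral_eq_integral integrable_op_norm_powr) auto

lemma moment_submult:
  assumes \<mu>: "contractive_law \<mu>" and s: "0 < s"
  shows "moment (conv_power \<mu> (m + n)) s \<le> moment (conv_power \<mu> m) s * moment (conv_power \<mu> n) s"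
proof -
  note c = contractive_law_conv_power[OF \<mu>]
  have "ennreal (moment (conv_power \<mu> (m + n)) s)
      = (\<integral>\<^sup>+B. \<integral>\<^sup>+A. ennreal (op_norm (A ** B) powr s) \<partial>conv_power \<mu> m \<partial>conv_power \<mu> n)"
    using s by (simp add: nn_integral_moment[OF c, symmetric] nn_integral_conv_power_add[OF \<mu>])
  also have "\<dots> \<le> (\<integral>\<^sup>+B. \<integral>\<^sup>+A. ennreal (op_norm A powr s) * ennreal (op_norm B powr s)
      \<partial>conv_power \<mu> m \<partial>conv_power \<mu> n)"
    using s op_norm_mult
    by (intro nn_integral_mono)
      (auto simp: op_norm_nonneg simp flip: ennreal_mult powr_mult intro!: ennreal_leI powr_mono2)
  also have "\<dots> = ennreal (moment (conv_power \<mu> m) s) * ennreal (moment (conv_power \<mu> n) s)"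
    using s by (simp add: nn_integral_multc nn_integral_cmult nn_integral_moment[OF c])
  finally show ?thesis
    by (simp add: moment_nonneg flip: ennreal_mult)
qed

text \<open>
  Jensen's inequality for \<open>x powr a\<close> on the closed half-line; it is proved by integrating the tangent line
  at the mean, so that \<open>f\<close> may vanish on a set of positive measure.
\<close>

lemma (in prob_space) powr_expectation_le:
  fixes f :: "'a \<Rightarrow> real"
  assumes f: "integrable M f" "integrable M (\<lambda>x. f x powr a)" "AE x in M. 0 \<le> f x" and a: "1 \<le> a"
  shows "expectation f powr a \<le> expectation (\<lambda>x. f x powr a)"
proof (cases "expectation f = 0")
  case True
  moreover have "0 \<le> expectation (\<lambda>x. f x powr a)"
    by (rule integral_nonneg_AE) simp
  ultimately show ?thesis by simp
next
  case False
  define m where "m = expectation f"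
  have m: "m > 0"
    using False integral_nonneg_AE[OF f(3)] by (simp add: m_def)
  have tangent: "m powr a + a * m powr (a - 1) * (x - m) \<le> x powr a" if x: "0 \<le> x" for x
  proof -
    have "1 + a * (x / m - 1) \<le> (x / m) powr a"
    proof (cases "x = 0")
      case False
      then have "((x / m) powr a) powr (1 / a) * 1 powr (1 - 1 / a) \<le> 1 / a * (x / m) powr a + (1 - 1 / a) * 1"
        using a x m by (intro Youngs_inequality_0) auto
      moreover have "((x / m) powr a) powr (1 / a) = x / m"
        using a x m by (simp add: powr_powr)
      ultimately have "x / m \<le> 1 / a * (x / m) powr a + (1 - 1 / a)" by simp
      then have "a * (x / m) \<le> a * (1 / a * (x / m) powr a + (1 - 1 / a))"
        using a by (intro mult_left_mono) auto
      also have "\<dots> = (x / m) powr a + (a - 1)"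
        using a by (simp add: field_simps)
      finally show ?thesis by (simp add: algebra_simps)
    qed (use a in simp)
    then have "m powr a * (1 + a * (x / m - 1)) \<le> m powr a * (x / m) powr a"
      by (intro mult_left_mono) auto
    also have "m powr a * (x / m) powr a = x powr a"
      using x m by (simp flip: powr_mult)
    also have "m powr a * (1 + a * (x / m - 1)) = m powr a + a * m powr (a - 1) * (x - m)"
      using m by (simp add: powr_diff field_simps)
    finally show ?thesis .
  qed
  have "expectation (\<lambda>x. m powr a + a * m powr (a - 1) * (f x - m)) \<le> expectation (\<lambda>x. f x powr a)"
    using f tangent by (intro integral_mono_AE) (auto simp: prob_space_axioms)
  moreover have "expectation (\<lambda>x. m powr a + a * m powr (a - 1) * (f x - m)) = m powr a"
    using f(1) by (simp add: m_def prob_space)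
  ultimately show ?thesis by (simp add: m_def)
qed

text \<open>
  Together with \<open>moment_antimono\<close> this compares any two moments of a contractive law with each other, up to
  a power.
\<close>

lemma moment_powr_le:
  assumes \<mu>: "contractive_law \<mu>" and "0 < p" "p \<le> q"
  shows "moment \<mu> p powr (q / p) \<le> moment \<mu> q"
proof -
  interpret prob_space \<mu> using \<mu> by (rule contractive_lawD)
  have "moment \<mu> p powr (q / p) \<le> (\<integral>A. (op_norm A powr p) powr (q / p) \<partial>\<mu>)"
    unfolding moment_def using assms
    by (intro powr_expectation_le) (auto simp: powr_powr intro!: integrable_op_norm_powr)
  then show ?thesis using assms by (simp add: powr_powr moment_def)
qed

lemma nn_integral_normalized_law:
  fixes h :: "real^'n^'n \<Rightarrow> ennreal"
  assumes \<mu>: "sets \<mu> = sets borel" and pos: "0 < moment \<mu> s"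
    and h: "h \<in> borel_measurable borel"
    and hom: "\<And>c A. 0 \<le> c \<Longrightarrow> h (c *\<^sub>R A) = ennreal (c powr s) * h A"
  shows "(\<integral>\<^sup>+A. h A \<partial>\<mu>) = ennreal (moment \<mu> s) * (\<integral>\<^sup>+A. h A \<partial>normalized_law \<mu> s)"
proof -
  note [measurable] = h and [measurable_cong] = \<mu>
  have eq: "ennreal (moment \<mu> s) * (ennreal (op_norm A powr s / moment \<mu> s) * h (A /\<^sub>R op_norm A)) = h A" for A
  proof -
    have "ennreal (moment \<mu> s) * ennreal (op_norm A powr s / moment \<mu> s) = ennreal (op_norm A powr s)"
      using pos by (simp flip: ennreal_mult)
    then have "ennreal (moment \<mu> s) * (ennreal (op_norm A powr s / moment \<mu> s) * h (A /\<^sub>R op_norm A))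
        = h (op_norm A *\<^sub>R (A /\<^sub>R op_norm A))"
      by (simp only: hom[OF op_norm_nonneg] mult.assoc[symmetric])
    also have "op_norm A *\<^sub>R (A /\<^sub>R op_norm A) = A"
      by (cases "A = 0") (simp_all add: op_norm_eq_0_iff)
    finally show ?thesis .
  qed
  have "(\<integral>\<^sup>+A. h A \<partial>normalized_law \<mu> s)
      = (\<integral>\<^sup>+A. ennreal (op_norm A powr s / moment \<mu> s) * h (A /\<^sub>R op_norm A) \<partial>\<mu>)"
    unfolding normalized_law_def by (simp add: nn_integral_distr nn_integral_density)
  also have "ennreal (moment \<mu> s) * \<dots>
      = (\<integral>\<^sup>+A. ennreal (moment \<mu> s) * (ennreal (op_norm A powr s / moment \<mu> s) * h (A /\<^sub>R op_norm A)) \<partial>\<mu>)"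
    by (rule nn_integral_cmult[symmetric]) measurable
  finally show ?thesis by (simp add: eq)
qed

lemma contractive_law_normalized_law:
  assumes \<mu>: "contractive_law \<mu>" "sets \<mu> = sets borel" and s: "0 < s" and pos: "0 < moment \<mu> s"
  shows "contractive_law (normalized_law \<mu> s)"
proof -
  note [measurable_cong] = \<mu>(2)
  have "prob_space (density \<mu> (\<lambda>A. ennreal (op_norm A powr s / moment \<mu> s)))"
  proof (rule prob_spaceI)
    have "(\<integral>\<^sup>+A. ennreal (op_norm A powr s / moment \<mu> s) \<partial>\<mu>)
        = ennreal (\<integral>A. op_norm A powr s / moment \<mu> s \<partial>\<mu>)"
      using pos by (intro nn_integral_eq_integral integrable_divide integrable_op_norm_powr \<mu> s) auto
    also have "(\<integral>A. op_norm A powr s / moment \<mu> s \<partial>\<mu>) = 1"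
      using pos by (simp add: moment_def)
    finally show "emeasure (density \<mu> (\<lambda>A. ennreal (op_norm A powr s / moment \<mu> s)))
        (space (density \<mu> (\<lambda>A. ennreal (op_norm A powr s / moment \<mu> s)))) = 1"
      by (simp add: emeasure_density)
  qed
  then have "prob_space (normalized_law \<mu> s)"
    unfolding normalized_law_def by (rule prob_space.prob_space_distr) measurable
  moreover have "AE A in normalized_law \<mu> s. op_norm A \<le> 1"
  proof -
    have "op_norm (A /\<^sub>R op_norm A) \<le> 1" for A :: "real^'n^'n"
    proof (cases "A = 0")
      case True
      then show ?thesis using op_norm_eq_0_iff[of A] by simp
    next
      case False
      then show ?thesis by (simp add: op_norm_scaleR op_norm_nonneg op_norm_eq_0_iff)
    qed
    then show ?thesis
      unfolding normalized_law_def by (subst AE_distr_iff) auto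
  qed
  moreover have "(\<lambda>A. A) \<in> borel_measurable (normalized_law \<mu> s)"
    by (simp add: normalized_law_def)
  ultimately show ?thesis
    by (simp add: contractive_law_def)
qed

text \<open>
  Positively homogeneous integrands see a random matrix only through its norm and its direction. The norm
  of each of the \<open>k\<close> blocks of length \<open>n\<close> can therefore be pulled out, one block at a time. The
  induction runs over all homogeneous \<open>h\<close>, because integrating out some of the factors of a product yields
  another homogeneous function of the rest.
\<close>

lemma nn_integral_conv_power_normalized_law:
  fixes h :: "real^'n^'n \<Rightarrow> ennreal"
  assumes \<mu>: "contractive_law \<mu>" and s: "0 < s" and pos: "0 < moment (conv_power \<mu> n) s"
    and h: "h \<in> borel_measurable borel"
    and hom: "\<And>c A. 0 \<le> c \<Longrightarrow> h (c *\<^sub>R A) = ennreal (c powr s) * h A"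
  shows "(\<integral>\<^sup>+A. h A \<partial>conv_power \<mu> (k * n))
       = ennreal (moment (conv_power \<mu> n) s ^ k)
         * (\<integral>\<^sup>+A. h A \<partial>conv_power (normalized_law (conv_power \<mu> n) s) k)"
  using h hom
proof (induction k arbitrary: h)
  case 0
  then show ?case by (simp add: nn_integral_conv_power_0)
next
  case (Suc k)
  let ?W = "moment (conv_power \<mu> n) s" and ?\<pi> = "normalized_law (conv_power \<mu> n) s"
  note [measurable] = Suc.prems(1)
  have \<pi>: "contractive_law ?\<pi>"
    by (intro contractive_law_normalized_law contractive_law_conv_power \<mu> s pos) simp
  interpret N: prob_space "conv_power ?\<pi> k" using \<pi> by (rule prob_space_conv_power)
  have sc: "(c *\<^sub>R A) ** B = c *\<^sub>R (A ** B)" "A ** (c *\<^sub>R B) = c *\<^sub>R (A ** B)" for c and A B :: "real^'n^'n"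
    by (simp_all add: matrix_eq scaleR_matrix_vector_assoc[symmetric] matrix_vector_mult_scaleR
        flip: matrix_vector_mul_assoc)
  have "(\<integral>\<^sup>+A. h A \<partial>conv_power \<mu> (Suc k * n))
      = (\<integral>\<^sup>+B. \<integral>\<^sup>+A. h (A ** B) \<partial>conv_power \<mu> (k * n) \<partial>conv_power \<mu> n)"
    using nn_integral_conv_power_add[OF \<mu> Suc.prems(1), of "k * n" n] by (simp add: add.commute)
  also have "\<dots> = (\<integral>\<^sup>+B. ennreal (?W ^ k) * (\<integral>\<^sup>+A. h (A ** B) \<partial>conv_power ?\<pi> k) \<partial>conv_power \<mu> n)"
    by (intro nn_integral_cong Suc.IH) (auto simp: sc Suc.prems(2))
  also have "\<dots> = ennreal (?W ^ k) * (\<integral>\<^sup>+B. \<integral>\<^sup>+A. h (A ** B) \<partial>conv_power ?\<pi> k \<partial>conv_power \<mu> n)"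
    by (rule nn_integral_cmult) measurable
  also have "(\<integral>\<^sup>+B. \<integral>\<^sup>+A. h (A ** B) \<partial>conv_power ?\<pi> k \<partial>conv_power \<mu> n)
      = ennreal ?W * (\<integral>\<^sup>+B. \<integral>\<^sup>+A. h (A ** B) \<partial>conv_power ?\<pi> k \<partial>?\<pi>)"
  proof (rule nn_integral_normalized_law[OF sets_conv_power pos])
    show "(\<lambda>B. \<integral>\<^sup>+A. h (A ** B) \<partial>conv_power ?\<pi> k) \<in> borel_measurable borel" by measurable
    show "(\<integral>\<^sup>+A. h (A ** (c *\<^sub>R B)) \<partial>conv_power ?\<pi> k) = ennreal (c powr s) * (\<integral>\<^sup>+A. h (A ** B) \<partial>conv_power ?\<pi> k)"
      if "0 \<le> c" for c B
      using that by (simp add: sc Suc.prems(2) nn_integral_cmult)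
  qed
  also have "(\<integral>\<^sup>+B. \<integral>\<^sup>+A. h (A ** B) \<partial>conv_power ?\<pi> k \<partial>?\<pi>) = (\<integral>\<^sup>+A. h A \<partial>conv_power ?\<pi> (Suc k))"
    by (rule nn_integral_conv_power_Suc[OF \<pi> Suc.prems(1), symmetric])
  finally show ?case
    using pos by (simp add: ennreal_mult ac_simps)
qed

lemma moment_conv_power_normalized_law:
  assumes \<mu>: "contractive_law \<mu>" and s: "0 < s" and pos: "0 < moment (conv_power \<mu> n) s"
  shows "moment (conv_power \<mu> (k * n)) s
       = moment (conv_power \<mu> n) s ^ k * moment (conv_power (normalized_law (conv_power \<mu> n) s) k) s"
proof -
  let ?\<pi> = "normalized_law (conv_power \<mu> n) s"
  have \<pi>: "contractive_law ?\<pi>"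
    by (intro contractive_law_normalized_law contractive_law_conv_power \<mu> s pos) simp
  have "(\<integral>\<^sup>+A. ennreal (op_norm A powr s) \<partial>conv_power \<mu> (k * n))
      = ennreal (moment (conv_power \<mu> n) s ^ k) * (\<integral>\<^sup>+A. ennreal (op_norm A powr s) \<partial>conv_power ?\<pi> k)"
    by (intro nn_integral_conv_power_normalized_law[OF \<mu> s pos])
      (auto simp: op_norm_scaleR powr_mult op_norm_nonneg ennreal_mult)
  then show ?thesis
    using pos
    by (simp add: nn_integral_moment contractive_law_conv_power \<mu> \<pi> s moment_nonneg flip: ennreal_mult)
qed

text \<open>
  With \<open>\<pi>\<close> the normalised law of a block of length \<open>n\<close>, an upper bound \<open>C * R ^ k\<close> for the moments of
  \<open>k\<close> blocks turns, through \<open>a\<close>, into a bound \<open>O(((R / W) powr (1 / a)) ^ k)\<close> for the second moments of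
  \<open>\<pi>\<close>. Then \<open>second_moment_bound\<close> limits the second moment of \<open>d\<close> blocks, and \<open>b\<close> translates
  back to the exponent \<open>s\<close>.
\<close>

lemma growth_lower_bound:
  fixes \<mu> :: "(real^'n^'n) measure"
  defines "d \<equiv> CARD('n)"
  assumes \<mu>: "contractive_law \<mu>" and s: "0 < s" and pos: "0 < moment (conv_power \<mu> n) s"
    and R: "0 < R" and growth: "\<And>k. moment (conv_power \<mu> (k * n)) s \<le> C * R ^ k"
  shows "moment (conv_power \<mu> n) s
           * (moment (conv_power \<mu> (d * n)) s / moment (conv_power \<mu> n) s ^ d) powr (max 1 (s / 2) * max 1 (2 / s))
         \<le> (real d ^ (2 * d + 2)) powr max 1 (s / 2) * R"
proof -
  define W where "W = moment (conv_power \<mu> n) s"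
  define \<pi> where "\<pi> = normalized_law (conv_power \<mu> n) s"
  define a where "a = max 1 (s / 2)"
  define b where "b = max 1 (2 / s)"
  define D where "D = real d ^ (2 * d + 2)"
  have W: "W > 0" using pos by (simp add: W_def)
  have a: "a \<ge> 1" by (simp add: a_def)
  have D: "D > 0" by (simp add: D_def d_def)
  have \<pi>: "contractive_law \<pi>" unfolding \<pi>_def
    by (intro contractive_law_normalized_law contractive_law_conv_power \<mu> s pos) simp
  note c = contractive_law_conv_power[OF \<pi>]
  have e: "moment (conv_power \<pi> k) s = moment (conv_power \<mu> (k * n)) s / W ^ k" for k
    using moment_conv_power_normalized_law[OF \<mu> s pos, of k] W by (simp add: W_def \<pi>_def)
  have g_e: "moment (conv_power \<pi> k) 2 powr a \<le> moment (conv_power \<pi> k) s" for k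
    using moment_antimono[OF c, of s 2 k] moment_powr_le[OF c, of 2 s k] s
    by (cases "s \<le> 2") (auto simp: a_def max_def moment_nonneg)
  have e_g: "moment (conv_power \<pi> k) s powr b \<le> moment (conv_power \<pi> k) 2" for k
    using moment_antimono[OF c, of 2 s k] moment_powr_le[OF c, of s 2 k] s
    by (cases "s \<le> 2") (auto simp: b_def max_def moment_nonneg divide_simps split: if_splits)
  have C: "C > 0"
    using growth[of 0] by (simp add: moment_def integral_conv_power_0 op_norm_mat_1)
  define r where "r = (R / W) powr (1 / a)"
  have "moment (conv_power \<pi> k) 2 \<le> C powr (1 / a) * r ^ k" for k
  proof -
    have "moment (conv_power \<pi> k) 2 = (moment (conv_power \<pi> k) 2 powr a) powr (1 / a)"
      using a by (simp add: powr_powr moment_nonneg)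
    also have "\<dots> \<le> (C * R ^ k / W ^ k) powr (1 / a)"
      using g_e[of k] growth[of k] W a unfolding e
      by (intro powr_mono2) (auto simp: divide_right_mono intro: order_trans)
    also have "\<dots> = C powr (1 / a) * r ^ k"
    proof -
      have "(C * R ^ k / W ^ k) powr (1 / a) = C powr (1 / a) * ((R / W) powr real k) powr (1 / a)"
        using R W by (simp add: powr_realpow power_divide flip: powr_mult)
      also have "((R / W) powr real k) powr (1 / a) = r powr real k"
        unfolding r_def by (rule powr_powr_swap)
      also have "\<dots> = r ^ k"
        using R W by (intro powr_realpow) (simp add: r_def)
      finally show ?thesis .
    qed
    finally show ?thesis .
  qed
  then have "(\<integral>A. (op_norm A)\<^sup>2 \<partial>conv_power \<pi> k) \<le> C powr (1 / a) * r ^ k" for k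
    by (simp add: moment_def powr_numeral op_norm_nonneg)
  from second_moment_bound[OF \<pi> _ this]
  have "(\<integral>A. (op_norm A)\<^sup>2 \<partial>conv_power \<pi> d) \<le> D * r"
    using R W by (simp add: D_def d_def r_def)
  then have "moment (conv_power \<pi> d) 2 \<le> D * r"
    by (simp add: moment_def powr_numeral op_norm_nonneg)
  with e_g[of d] have "moment (conv_power \<pi> d) s powr b \<le> D * r" by linarith
  then have "(moment (conv_power \<pi> d) s powr b) powr a \<le> (D * r) powr a"
    using a by (intro powr_mono2) auto
  also have "\<dots> = D powr a * R / W"
    using D R W a by (simp add: powr_mult r_def powr_powr)
  finally have "W * moment (conv_power \<pi> d) s powr (a * b) \<le> D powr a * R"
    using W by (simp add: powr_powr field_simps)
  then show ?thesis
    unfolding e by (simp add: W_def a_def b_def D_def)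
qed


section \<open>The norm pressure as a growth rate\<close>

definition growth_rate :: "(nat \<Rightarrow> real) \<Rightarrow> real" where
  "growth_rate u = (INF n\<in>{1..}. root n (u n))"

lemma
  assumes "\<And>n. 0 \<le> u n"
  shows growth_rate_nonneg: "0 \<le> growth_rate u"
    and growth_rate_le_root: "1 \<le> n \<Longrightarrow> growth_rate u \<le> root n (u n)"
proof -
  have "0 \<le> root n (u n)" for n by (rule real_root_ge_zero[OF assms])
  then show "0 \<le> growth_rate u" "1 \<le> n \<Longrightarrow> growth_rate u \<le> root n (u n)"
    unfolding growth_rate_def by (auto intro!: cINF_greatest cINF_lower bdd_belowI2[where m = 0])
qed

text \<open>
  The quantitative half of Fekete's lemma: division with remainder by a single good index \<open>n\<close>.
\<close>

lemma submultiplicative_exponential_bound: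
  fixes u :: "nat \<Rightarrow> real"
  assumes u: "\<And>n. 0 \<le> u n" "\<And>n. u n \<le> 1" and sub: "\<And>m n. u (m + n) \<le> u m * u n"
    and b: "growth_rate u < b"
  obtains C where "0 < C" "\<And>m. u m \<le> C * b ^ m"
proof -
  have "bdd_below ((\<lambda>n. root n (u n)) ` {1..})"
    using u by (auto intro!: bdd_belowI2[where m = 0] real_root_ge_zero)
  then obtain n where n: "1 \<le> n" "root n (u n) < b"
    using b unfolding growth_rate_def by (subst (asm) cINF_less_iff) auto
  have b0: "b > 0" using b growth_rate_nonneg[of u, OF u(1)] by linarith
  have un: "u n \<le> b ^ n"
  proof -
    have "u n = root n (u n) ^ n" using n u by simp
    also have "\<dots> \<le> b ^ n" using n u by (intro power_mono) auto
    finally show ?thesis .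
  qed
  have upow: "u (q * n) \<le> (b ^ n) ^ q" for q
  proof (induction q)
    case (Suc q)
    have "u (Suc q * n) \<le> u n * u (q * n)" using sub[of n "q * n"] by simp
    also have "\<dots> \<le> b ^ n * (b ^ n) ^ q" using Suc un u b0 by (intro mult_mono) auto
    finally show ?case by simp
  qed (use u in simp)
  define c where "c = min 1 (b ^ n)"
  have c: "c > 0" using b0 by (simp add: c_def)
  have "u m \<le> 1 / c * b ^ m" for m
  proof -
    define q j where "q = m div n" and "j = m mod n"
    have m: "m = q * n + j" and j: "j \<le> n"
      using n by (simp_all add: q_def j_def less_imp_le)
    have cj: "c \<le> b ^ j"
    proof (cases "b \<le> 1")
      case True
      then have "b ^ n \<le> b ^ j" using j b0 by (intro power_decreasing) auto
      then show ?thesis by (simp add: c_def)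
    next
      case False
      then have "1 \<le> b ^ j" by (intro one_le_power) auto
      then show ?thesis by (simp add: c_def)
    qed
    have "u m \<le> u (q * n) * u j" unfolding m by (rule sub)
    also have "\<dots> \<le> (b ^ n) ^ q * 1" using upow[of q] u b0 by (intro mult_mono) auto
    finally have "u m * c \<le> (b ^ n) ^ q * b ^ j"
      using cj c u b0 by (intro mult_mono) auto
    also have "\<dots> = b ^ m" unfolding m by (simp add: power_add power_mult[symmetric] mult.commute)
    finally show ?thesis using c by (simp add: field_simps)
  qed
  with c show thesis by (intro that[of "1 / c"]) auto
qed

lemma root_tendsto_growth_rate:
  fixes u :: "nat \<Rightarrow> real"
  assumes u: "\<And>n. 0 \<le> u n" "\<And>n. u n \<le> 1" and sub: "\<And>m n. u (m + n) \<le> u m * u n"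
  shows "(\<lambda>n. root n (u n)) \<longlonglongrightarrow> growth_rate u"
proof (rule order_tendstoI)
  fix a assume "a < growth_rate u"
  then have "a < root n (u n)" if "1 \<le> n" for n
    using growth_rate_le_root[of u n] u that by (auto intro: less_le_trans)
  then show "\<forall>\<^sub>F n in sequentially. a < root n (u n)"
    by (intro eventually_sequentiallyI[of 1])
next
  fix a assume "growth_rate u < a"
  then obtain b where b: "growth_rate u < b" "b < a" using dense by blast
  obtain C where C: "0 < C" "\<And>m. u m \<le> C * b ^ m"
    using submultiplicative_exponential_bound[OF u sub b(1)] by blast
  have b0: "b > 0" using b growth_rate_nonneg[of u, OF u(1)] by linarith
  have "(\<lambda>n. root n C * b) \<longlonglongrightarrow> 1 * b"
    by (intro tendsto_intros LIMSEQ_root_const C)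
  then have "\<forall>\<^sub>F n in sequentially. root n C * b < a"
    using b by (intro order_tendstoD(2)) auto
  then show "\<forall>\<^sub>F n in sequentially. root n (u n) < a"
    using eventually_ge_at_top[of 1]
  proof eventually_elim
    case (elim n)
    have "root n (u n) \<le> root n (C * b ^ n)"
      using elim C by (intro real_root_le_mono) auto
    also have "\<dots> = root n C * b"
      using elim b0 by (simp add: real_root_mult real_root_power_cancel)
    finally show ?case using elim by simp
  qed
qed

definition moment_rate :: "(real^'n^'n) measure \<Rightarrow> real \<Rightarrow> real" where
  "moment_rate \<mu> s = growth_rate (\<lambda>n. moment (conv_power \<mu> n) s)"

text \<open>
  The bound \<open>growth_lower_bound\<close> holds for \<open>R = b ^ n\<close> with any \<open>b\<close> above the growth rate; let \<open>b\<close>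
  decrease to it.
\<close>

lemma moment_rate_lower_bound:
  fixes \<mu> :: "(real^'n^'n) measure"
  defines "d \<equiv> CARD('n)"
  assumes \<mu>: "contractive_law \<mu>" and s: "0 < s" and pos: "0 < moment (conv_power \<mu> n) s"
  shows "moment (conv_power \<mu> n) s
           * (moment (conv_power \<mu> (d * n)) s / moment (conv_power \<mu> n) s ^ d) powr (max 1 (s / 2) * max 1 (2 / s))
         \<le> (real d ^ (2 * d + 2)) powr max 1 (s / 2) * moment_rate \<mu> s ^ n" (is "?X \<le> ?D * _")
proof -
  let ?u = "\<lambda>n. moment (conv_power \<mu> n) s" and ?r = "moment_rate \<mu> s"
  have "?X \<le> ?D * b ^ n" if b: "?r < b" for b
  proof -
    obtain C where C: "\<And>m. ?u m \<le> C * b ^ m"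
      using submultiplicative_exponential_bound[of ?u b] b s \<mu>
      by (auto simp: moment_rate_def moment_nonneg moment_le_1 moment_submult contractive_law_conv_power)
    have "b > 0"
      using b growth_rate_nonneg[of ?u] by (simp add: moment_rate_def moment_nonneg)
    moreover have "?u (k * n) \<le> C * (b ^ n) ^ k" for k
      using C[of "k * n"] by (simp add: power_mult[symmetric] mult.commute)
    ultimately show ?thesis
      unfolding d_def by (intro growth_lower_bound[OF \<mu> s pos]) auto
  qed
  then have "\<forall>\<^sub>F b in at_right ?r. ?X \<le> ?D * b ^ n"
    by (auto simp: eventually_at_filter)
  moreover have "((\<lambda>b. ?D * b ^ n) \<longlongrightarrow> ?D * ?r ^ n) (at_right ?r)"
    by (intro tendsto_intros)
  ultimately show ?thesis
    by (intro tendsto_lowerbound[where F = "at_right ?r"]) auto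
qed

text \<open>
  The value at negative arguments makes this function continuous on the whole real line.
\<close>

definition ln_ext :: "real \<Rightarrow> ereal" where
  "ln_ext x = (if x \<le> 0 then -\<infinity> else ereal (ln x))"

lemma tendsto_ln_ext:
  assumes "(f \<longlongrightarrow> l) F"
  shows "((\<lambda>x. ln_ext (f x)) \<longlongrightarrow> ln_ext l) F"
proof (cases "0 < l")
  case True
  then have "\<forall>\<^sub>F x in F. ln_ext (f x) = ereal (ln (f x))"
    using order_tendstoD(1)[OF assms True] by (auto simp: ln_ext_def elim: eventually_mono)
  moreover have "((\<lambda>x. ereal (ln (f x))) \<longlongrightarrow> ereal (ln l)) F"
    using True assms by (intro tendsto_intros) auto
  ultimately show ?thesis
    using True by (simp add: ln_ext_def tendsto_cong)
next
  case False
  have "\<forall>\<^sub>F x in F. ln_ext (f x) < ereal r" for r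
  proof -
    have "l < exp r" using False by (intro le_less_trans[of l 0]) auto
    from order_tendstoD(2)[OF assms this] show ?thesis
    proof eventually_elim
      case (elim x)
      then show ?case
        using ln_less_cancel_iff[of "f x" "exp r"] by (auto simp: ln_ext_def simp del: ln_less_cancel_iff)
    qed
  qed
  then show ?thesis using False by (simp add: ln_ext_def tendsto_MInfty)
qed

lemma norm_pressure_eq:
  assumes \<mu>: "contractive_law \<mu>" and s: "0 < s"
  shows "norm_pressure \<mu> s = ln_ext (moment_rate \<mu> s)"
proof -
  let ?u = "\<lambda>n. moment (conv_power \<mu> n) s"
  have u: "0 \<le> ?u n" for n by (rule moment_nonneg)
  have "ereal (1 / real n) * ext_log (ennreal (?u n)) = ln_ext (root n (?u n))" if "1 \<le> n" for n
    using that u[of n] by (cases "?u n = 0") (auto simp: ext_log_def ln_ext_def ln_root)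
  then have "\<forall>\<^sub>F n in sequentially. ln_ext (root n (?u n)) = ereal (1 / real n) * ext_log (ennreal (?u n))"
    by (intro eventually_sequentiallyI[of 1]) simp
  moreover have "(\<lambda>n. ln_ext (root n (?u n))) \<longlonglongrightarrow> ln_ext (moment_rate \<mu> s)"
    unfolding moment_rate_def using \<mu> s
    by (intro tendsto_ln_ext root_tendsto_growth_rate)
      (auto simp: moment_nonneg moment_le_1 moment_submult contractive_law_conv_power)
  ultimately have "(\<lambda>n. ereal (1 / real n) * ext_log (ennreal (?u n))) \<longlonglongrightarrow> ln_ext (moment_rate \<mu> s)"
    by (rule Lim_transform_eventually[rotated])
  then show ?thesis
    unfolding norm_pressure_def using s
    by (simp add: nn_integral_moment[OF contractive_law_conv_power[OF \<mu>]] limI)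
qed


section \<open>Weak-* continuity of the moments\<close>

lemma continuous_map_weak_star_integral:
  fixes f :: "real^'n^'n \<Rightarrow> real"
  assumes "continuous_on op_unit_ball f"
  shows "continuous_map weak_star_topology euclideanreal (\<lambda>\<mu>. \<integral>A. f A \<partial>\<mu>)"
  unfolding continuous_map_def topspace_weak_star_topology
proof (intro conjI allI impI)
  fix U :: "real set" assume "openin euclideanreal U"
  then show "openin weak_star_topology {\<mu> \<in> ball_prob_measures. (\<integral>A. f A \<partial>\<mu>) \<in> U}"
    unfolding weak_star_topology_def using assms
    by (intro topology_generated_by_Basis) auto
qed simp

lemma in_op_unit_ball_iff: "A \<in> op_unit_ball \<longleftrightarrow> op_norm A \<le> 1"
  by (simp add: op_unit_ball_def)

lemma matrix_mult_in_op_unit_ball: "A \<in> op_unit_ball \<Longrightarrow> B \<in> op_unit_ball \<Longrightarrow> A ** B \<in> op_unit_ball"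
  unfolding in_op_unit_ball_iff
  using op_norm_mult[of A B] mult_le_one[of "op_norm A" "op_norm B"] op_norm_nonneg[of B] by linarith

lemma abs_integral_diff_le:
  fixes f g :: "real^'n^'n \<Rightarrow> real"
  assumes \<mu>: "contractive_law \<mu>" and "integrable \<mu> f" "integrable \<mu> g"
    and e: "\<And>A. A \<in> op_unit_ball \<Longrightarrow> \<bar>f A - g A\<bar> \<le> e"
  shows "\<bar>(\<integral>A. f A \<partial>\<mu>) - (\<integral>A. g A \<partial>\<mu>)\<bar> \<le> e"
proof -
  interpret prob_space \<mu> using \<mu> by (rule contractive_lawD)
  have "\<bar>\<integral>A. f A - g A \<partial>\<mu>\<bar> \<le> (\<integral>A. \<bar>f A - g A\<bar> \<partial>\<mu>)"
    by (rule integral_abs_bound)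
  also have "\<dots> \<le> e"
    using assms contractive_lawD(3)[OF \<mu>]
    by (intro integral_le_const integrable_abs Bochner_Integration.integrable_diff)
      (auto simp: in_op_unit_ball_iff)
  finally show ?thesis using assms by simp
qed

lemma continuous_on_bounded_on_op_unit_ball:
  fixes f :: "real^'n^'n \<Rightarrow> real"
  assumes "continuous_on UNIV f"
  obtains K where "\<And>A. op_norm A \<le> 1 \<Longrightarrow> \<bar>f A\<bar> \<le> K"
proof -
  have "compact (f ` op_unit_ball)"
    using assms compact_op_unit_ball by (blast intro: compact_continuous_image continuous_on_subset)
  then obtain K where "\<forall>x\<in>f ` op_unit_ball. norm x \<le> K"
    using compact_imp_bounded bounded_iff by blast
  then show thesis by (intro that[of K]) (auto simp: in_op_unit_ball_iff)
qed

text \<open>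
  Splitting off the last factor, the integral becomes that of \<open>g \<mu>\<close> with respect to \<open>\<mu>\<close>, where
  \<open>g \<mu> B\<close> is an integral over the \<open>n\<close>-th convolution power. Both the integrand and the measure vary with
  \<open>\<mu>\<close>. By uniform continuity of \<open>f\<close> on the compact unit ball, all functions \<open>g \<mu>\<close> have the same modulus of
  continuity, so their convergence at finitely many points \<open>B\<close>, known by induction, is uniform up to a
  small error; the remaining integral of the fixed continuous function \<open>g \<mu>0\<close> converges by definition of
  the topology.
\<close>

lemma continuous_map_integral_conv_power:
  fixes f :: "real^'n^'n \<Rightarrow> real"
  assumes "continuous_on UNIV f"
  shows "continuous_map weak_star_topology euclideanreal (\<lambda>\<mu>. \<integral>A. f A \<partial>conv_power \<mu> n)"
  using assms
proof (induction n arbitrary: f)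
  case 0
  then have "f \<in> borel_measurable borel" by (rule borel_measurable_continuous_onI)
  then show ?case by (simp add: integral_conv_power_0)
next
  case (Suc n)
  let ?K = "op_unit_ball :: (real^'n^'n) set"
  obtain K where K: "\<And>A. op_norm A \<le> 1 \<Longrightarrow> \<bar>f A\<bar> \<le> K"
    using continuous_on_bounded_on_op_unit_ball[OF Suc.prems] by blast
  have fm [measurable]: "f \<in> borel_measurable borel"
    using Suc.prems by (rule borel_measurable_continuous_onI)
  have fint: "integrable \<nu> (\<lambda>A. f (A ** B))" if "contractive_law \<nu>" "B \<in> ?K" for \<nu> B
    using that matrix_mult_in_op_unit_ball[of _ B]
    by (intro integrable_contractive_law[where K = K]) (auto simp: in_op_unit_ball_iff intro!: K)
  define g where "g = (\<lambda>\<mu> B. \<integral>A. f (A ** B) \<partial>conv_power \<mu> n)"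
  have gK: "\<bar>g \<mu> B\<bar> \<le> K" if \<mu>: "contractive_law \<mu>" and B: "B \<in> ?K" for \<mu> B
  proof -
    have "\<bar>(\<integral>A. f (A ** B) \<partial>conv_power \<mu> n) - (\<integral>A. 0 \<partial>conv_power \<mu> n)\<bar> \<le> K"
      using \<mu> B matrix_mult_in_op_unit_ball[of _ B]
      by (intro abs_integral_diff_le contractive_law_conv_power fint)
        (auto simp: in_op_unit_ball_iff intro!: K)
    then show ?thesis by (simp add: g_def)
  qed
  have gm: "g \<mu> \<in> borel_measurable borel" if \<mu>: "contractive_law \<mu>" for \<mu>
  proof -
    interpret N: prob_space "conv_power \<mu> n" using \<mu> by (rule prob_space_conv_power)
    show ?thesis unfolding g_def by measurable
  qed
  have gint: "integrable \<mu> (g \<nu>)" if "contractive_law \<mu>" "contractive_law \<nu>" for \<mu> \<nu>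
    using that gm gK by (intro integrable_contractive_law[where K = K]) (auto simp: in_op_unit_ball_iff)
  have step: "(\<integral>A. f A \<partial>conv_power \<mu> (Suc n)) = (\<integral>B. g \<mu> B \<partial>\<mu>)" if "contractive_law \<mu>" for \<mu>
    unfolding g_def by (rule integral_conv_power_Suc[OF that fm K])
  have unif: "\<exists>\<delta>>0. \<forall>\<mu> B B'. contractive_law \<mu> \<longrightarrow> B \<in> ?K \<longrightarrow> B' \<in> ?K \<longrightarrow> dist B B' < \<delta> \<longrightarrow>
      \<bar>g \<mu> B - g \<mu> B'\<bar> \<le> e" if e: "0 < e" for e
  proof -
    have "continuous_on (?K \<times> ?K) (\<lambda>X. f (fst X ** snd X))"
      by (intro continuous_on_compose2[OF Suc.prems] continuous_intros) auto
    then have "uniformly_continuous_on (?K \<times> ?K) (\<lambda>X. f (fst X ** snd X))"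
      by (intro compact_uniformly_continuous compact_Times compact_op_unit_ball)
    then obtain \<delta> where \<delta>: "\<delta> > 0"
      "\<And>X X'. X \<in> ?K \<times> ?K \<Longrightarrow> X' \<in> ?K \<times> ?K \<Longrightarrow> dist X' X < \<delta> \<Longrightarrow>
        dist (f (fst X' ** snd X')) (f (fst X ** snd X)) < e"
      using e unfolding uniformly_continuous_on_def by meson
    have "\<bar>g \<mu> B - g \<mu> B'\<bar> \<le> e" if "contractive_law \<mu>" "B \<in> ?K" "B' \<in> ?K" "dist B B' < \<delta>" for \<mu> B B'
      unfolding g_def using that
    proof (intro abs_integral_diff_le fint contractive_law_conv_power)
      fix A :: "real^'n^'n" assume "A \<in> ?K"
      then show "\<bar>f (A ** B) - f (A ** B')\<bar> \<le> e"
        using \<delta>(2)[of "(A, B')" "(A, B)"] that by (simp add: dist_Pair_Pair dist_real_def)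
    qed
    with \<delta>(1) show ?thesis by blast
  qed
  show ?case
    unfolding continuous_map_atin limitin_canonical_iff
  proof (intro ballI tendstoI)
    fix \<mu>0 :: "(real^'n^'n) measure" and e :: real
    assume \<mu>0: "\<mu>0 \<in> topspace weak_star_topology" and "0 < e"
    define F where "F = atin weak_star_topology \<mu>0"
    (* Three parts for the uniform distance of g \<mu> to g \<mu>0, one for the integral of g \<mu>0, one to spare. *)
    define e' where "e' = e / 5"
    have e': "0 < e'" using \<open>0 < e\<close> by (simp add: e'_def)
    have law0: "contractive_law \<mu>0"
      using \<mu>0 by (simp add: topspace_weak_star_topology contractive_law_ball_prob_measures)
    have law: "\<forall>\<^sub>F \<mu> in F. contractive_law \<mu>"
      unfolding F_def eventually_atin
      using openin_topspace[of "weak_star_topology :: (real^'n^'n) measure topology"] \<mu>0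
      by (auto simp: topspace_weak_star_topology intro!: contractive_law_ball_prob_measures)
    obtain \<delta> where \<delta>: "\<delta> > 0" "\<And>\<mu> B B'. contractive_law \<mu> \<Longrightarrow> B \<in> ?K \<Longrightarrow> B' \<in> ?K \<Longrightarrow> dist B B' < \<delta> \<Longrightarrow>
      \<bar>g \<mu> B - g \<mu> B'\<bar> \<le> e'"
      using unif[OF e'] by blast
    obtain T where "finite T \<and> T \<subseteq> ?K \<and> ?K \<subseteq> (\<Union>B\<in>T. ball B \<delta>)"
      using seq_compact_imp_totally_bounded[OF compact_imp_seq_compact[OF compact_op_unit_ball],
          rule_format, OF \<delta>(1)] by (elim exE)
    then have T: "finite T" "T \<subseteq> ?K" "?K \<subseteq> (\<Union>B\<in>T. ball B \<delta>)" by simp_all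
    have "\<forall>\<^sub>F \<mu> in F. dist (g \<mu> B) (g \<mu>0 B) < e'" for B
    proof -
      have "continuous_on UNIV (\<lambda>A. f (A ** B))"
        by (intro continuous_on_compose2[OF Suc.prems] continuous_intros) auto
      from Suc.IH[OF this] show ?thesis
        unfolding continuous_map_atin limitin_canonical_iff g_def F_def
        using \<mu>0 e' by (blast dest: tendstoD)
    qed
    then have "\<forall>\<^sub>F \<mu> in F. \<forall>B\<in>T. dist (g \<mu> B) (g \<mu>0 B) < e'"
      using T(1) by (intro eventually_ball_finite) auto
    moreover have "\<forall>\<^sub>F \<mu> in F. dist (\<integral>B. g \<mu>0 B \<partial>\<mu>) (\<integral>B. g \<mu>0 B \<partial>\<mu>0) < e'"
    proof -
      have "continuous_on ?K (g \<mu>0)"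
        unfolding continuous_on_iff
      proof (intro ballI allI impI)
        fix B and r :: real assume B: "B \<in> ?K" "0 < r"
        with unif[of "r / 2"] law0 obtain \<eta> where "\<eta> > 0"
          "\<forall>B'\<in>?K. dist B' B < \<eta> \<longrightarrow> \<bar>g \<mu>0 B' - g \<mu>0 B\<bar> \<le> r / 2"
          by (meson half_gt_zero)
        then show "\<exists>\<eta>>0. \<forall>B'\<in>?K. dist B' B < \<eta> \<longrightarrow> dist (g \<mu>0 B') (g \<mu>0 B) < r"
          using B by (intro exI[of _ \<eta>]) (force simp: dist_real_def)
      qed
      from continuous_map_weak_star_integral[OF this] show ?thesis
        unfolding continuous_map_atin limitin_canonical_iff F_def
        using \<mu>0 e' by (blast dest: tendstoD)
    qed
    ultimately show "\<forall>\<^sub>F \<mu> in atin weak_star_topology \<mu>0.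
        dist (\<integral>A. f A \<partial>conv_power \<mu> (Suc n)) (\<integral>A. f A \<partial>conv_power \<mu>0 (Suc n)) < e"
      using law unfolding F_def[symmetric]
    proof eventually_elim
      case (elim \<mu>)
      have "\<bar>g \<mu> B - g \<mu>0 B\<bar> \<le> 3 * e'" if B: "B \<in> ?K" for B
      proof -
        obtain B' where B': "B' \<in> T" "dist B B' < \<delta>"
          using B T(3) by (auto simp: dist_commute)
        then have "\<bar>g \<mu> B - g \<mu> B'\<bar> \<le> e'" "\<bar>g \<mu>0 B - g \<mu>0 B'\<bar> \<le> e'"
          using \<delta>(2) elim(3) law0 T(2) B by auto
        moreover have "\<bar>g \<mu> B' - g \<mu>0 B'\<bar> < e'"
          using elim(1) B' by (auto simp: dist_real_def)
        ultimately show ?thesis by linarith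
      qed
      then have "\<bar>(\<integral>B. g \<mu> B \<partial>\<mu>) - (\<integral>B. g \<mu>0 B \<partial>\<mu>)\<bar> \<le> 3 * e'"
        using elim(3) law0 by (intro abs_integral_diff_le gint) auto
      with elim(2) e' show ?case
        unfolding step[OF elim(3)] step[OF law0] dist_real_def e'_def by linarith
    qed
  qed
qed

text \<open>
  With \<open>v = - s * ln x\<close> the difference is at most \<open>(t - s) / s * (v / exp v)\<close>. The bound does not
  depend on \<open>x\<close>, which is what makes the moments continuous in \<open>s\<close> uniformly over all contractive laws.
\<close>

lemma abs_powr_diff_le:
  fixes x :: real
  assumes x: "0 \<le> x" "x \<le> 1" and st: "0 < s" "s \<le> t"
  shows "\<bar>x powr s - x powr t\<bar> \<le> (t - s) / s"
proof (cases "x = 0")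
  case True
  then show ?thesis using st by simp
next
  case False
  define v where "v = - (s * ln x)"
  have v: "0 \<le> v" using x st False by (simp add: v_def mult_nonneg_nonpos)
  have t: "(t - s) / s * v = - ((t - s) * ln x)"
    using st by (simp add: v_def field_simps)
  have "x powr t \<le> x powr s" using x st by (intro powr_mono') auto
  moreover have "x powr s - x powr t = x powr s * (1 - x powr (t - s))"
    using False by (simp add: algebra_simps flip: powr_add)
  moreover have "1 - x powr (t - s) \<le> (t - s) / s * v"
  proof -
    have "x powr (t - s) = exp ((t - s) * ln x)" using False by (simp add: powr_def)
    then show ?thesis using exp_ge_add_one_self[of "(t - s) * ln x"] t by linarith
  qed
  moreover have "x powr s * ((t - s) / s * v) \<le> (t - s) / s"
  proof -
    have "x powr s * v = v / exp v" using False by (simp add: powr_def v_def exp_minus field_simps)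
    also have "v \<le> exp v" using exp_ge_add_one_self[of v] by linarith
    then have "v / exp v \<le> 1" by (simp add: divide_le_eq)
    finally have "(t - s) / s * (x powr s * v) \<le> (t - s) / s * 1"
      using st by (intro mult_left_mono) auto
    then show ?thesis by (simp add: ac_simps)
  qed
  ultimately show ?thesis
    by (smt (verit) mult_left_mono powr_ge_zero)
qed

lemma abs_moment_diff_le:
  assumes \<mu>: "contractive_law \<mu>" and st: "0 < s" "0 < t"
  shows "\<bar>moment \<mu> s - moment \<mu> t\<bar> \<le> \<bar>s - t\<bar> / min s t"
  unfolding moment_def
proof (rule abs_integral_diff_le[OF \<mu>])
  fix A :: "real^'n^'n" assume "A \<in> op_unit_ball"
  then show "\<bar>op_norm A powr s - op_norm A powr t\<bar> \<le> \<bar>s - t\<bar> / min s t"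
    using abs_powr_diff_le[of "op_norm A" s t] abs_powr_diff_le[of "op_norm A" t s] st
    by (cases "s \<le> t") (auto simp: in_op_unit_ball_iff op_norm_nonneg abs_minus_commute)
qed (use assms in \<open>auto intro: integrable_op_norm_powr\<close>)

lemma continuous_map_moment:
  "continuous_map (prod_topology (weak_star_topology :: (real^'n^'n) measure topology) (top_of_set {0<..}))
     euclideanreal (\<lambda>x. moment (conv_power (fst x) n) (snd x))" (is "continuous_map ?X _ _")
  unfolding continuous_map_atin limitin_canonical_iff
proof
  fix x0 assume x0: "x0 \<in> topspace ?X"
  define s0 where "s0 = snd x0"
  have s0: "0 < s0" using x0 by (auto simp: s0_def)
  define F where "F = atin ?X x0"
  have top: "\<forall>\<^sub>F x in F. x \<in> topspace ?X"
    unfolding F_def eventually_atin using openin_topspace[of ?X] x0 by blast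
  have "continuous_on UNIV (\<lambda>A::real^'n^'n. op_norm A powr s0)"
    using s0 by (intro continuous_on_powr' continuous_op_norm continuous_intros) (auto simp: op_norm_nonneg)
  then have "continuous_map weak_star_topology euclideanreal
      (\<lambda>\<mu>::(real^'n^'n) measure. moment (conv_power \<mu> n) s0)"
    unfolding moment_def by (rule continuous_map_integral_conv_power)
  then have "continuous_map ?X euclideanreal ((\<lambda>\<mu>. moment (conv_power \<mu> n) s0) \<circ> fst)"
    by (rule continuous_map_compose[OF continuous_map_fst])
  then have 1: "((\<lambda>x. moment (conv_power (fst x) n) s0) \<longlongrightarrow> moment (conv_power (fst x0) n) s0) F"
    using x0 unfolding continuous_map_atin limitin_canonical_iff F_def comp_def by blast
  have "continuous_map ?X euclideanreal snd"
    by (rule continuous_map_into_fulltopology[OF continuous_map_snd])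
  then have snd: "(snd \<longlongrightarrow> s0) F"
    using x0 unfolding continuous_map_atin limitin_canonical_iff F_def s0_def by blast
  have "((\<lambda>x. \<bar>snd x - s0\<bar> / min (snd x) s0) \<longlongrightarrow> \<bar>s0 - s0\<bar> / min s0 s0) F"
    using s0 by (intro tendsto_intros snd) auto
  then have "((\<lambda>x. \<bar>snd x - s0\<bar> / min (snd x) s0) \<longlongrightarrow> 0) F" by simp
  moreover have "\<forall>\<^sub>F x in F. norm (moment (conv_power (fst x) n) (snd x) - moment (conv_power (fst x) n) s0)
      \<le> \<bar>snd x - s0\<bar> / min (snd x) s0"
    using top
  proof eventually_elim
    case (elim x)
    then have "fst x \<in> ball_prob_measures" "0 < snd x"
      by (auto simp: topspace_weak_star_topology)
    then show ?case
      using s0 unfolding real_norm_def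
      by (intro abs_moment_diff_le contractive_law_conv_power contractive_law_ball_prob_measures)
  qed
  ultimately have "((\<lambda>x. moment (conv_power (fst x) n) (snd x) - moment (conv_power (fst x) n) s0) \<longlongrightarrow> 0) F"
    by (rule Lim_null_comparison[rotated])
  from tendsto_add[OF this 1]
  show "((\<lambda>x. moment (conv_power (fst x) n) (snd x)) \<longlongrightarrow> moment (conv_power (fst x0) n) (snd x0)) (atin ?X x0)"
    by (simp add: F_def s0_def)
qed


section \<open>Continuity of the norm pressure\<close>

text \<open>
  Upper semicontinuity comes from the bounds \<open>root n (u n x)\<close>, lower semicontinuity from the bounds \<open>L n x\<close>
  of \<open>moment_rate_lower_bound\<close>. Both are continuous in \<open>x\<close> for fixed \<open>n\<close> (the second one where
  all the moments are positive), and at the given point both tend to the rate as \<open>n\<close> grows, the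
  second one if the rate is positive there; otherwise its nonnegativity is enough.
\<close>

lemma moment_rate_continuous:
  fixes x0 :: "(real^'n^'n) measure \<times> real"
  defines "X \<equiv> prod_topology (weak_star_topology :: (real^'n^'n) measure topology) (top_of_set {0<..})"
  assumes x0: "x0 \<in> topspace X"
  shows "((\<lambda>x. moment_rate (fst x) (snd x)) \<longlongrightarrow> moment_rate (fst x0) (snd x0)) (atin X x0)"
proof -
  define F where "F = atin X x0"
  define u where "u = (\<lambda>n (x :: (real^'n^'n) measure \<times> real). moment (conv_power (fst x) n) (snd x))"
  define r where "r = (\<lambda>x :: (real^'n^'n) measure \<times> real. moment_rate (fst x) (snd x))"
  define d where "d = CARD('n)"
  have law: "contractive_law (fst x)" "0 < snd x" if "x \<in> topspace X" for x
    using that by (auto simp: X_def topspace_weak_star_topology intro: contractive_law_ball_prob_measures)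
  have top: "\<forall>\<^sub>F x in F. x \<in> topspace X"
    unfolding F_def eventually_atin using openin_topspace[of X] x0 by blast
  have u_lim: "(u n \<longlongrightarrow> u n x0) F" for n
    using continuous_map_moment[of n] x0
    unfolding continuous_map_atin limitin_canonical_iff u_def F_def X_def by blast
  have s_lim: "(snd \<longlongrightarrow> snd x0) F"
  proof -
    have "continuous_map X euclideanreal snd"
      unfolding X_def by (rule continuous_map_into_fulltopology[OF continuous_map_snd])
    then show ?thesis
      using x0 unfolding continuous_map_atin limitin_canonical_iff F_def by blast
  qed
  have u_nonneg: "0 \<le> u n x" for n x by (simp add: u_def moment_nonneg)
  have r_le: "r x \<le> root n (u n x)" if "1 \<le> n" for n x
    unfolding r_def moment_rate_def u_def using that by (intro growth_rate_le_root moment_nonneg)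
  have r_nonneg: "0 \<le> r x" for x
    unfolding r_def moment_rate_def by (intro growth_rate_nonneg moment_nonneg)
  have r_lim: "(\<lambda>n. root n (u n x)) \<longlonglongrightarrow> r x" if "x \<in> topspace X" for x
    unfolding r_def moment_rate_def u_def using law[OF that]
    by (intro root_tendsto_growth_rate)
      (auto simp: moment_nonneg moment_le_1 moment_submult contractive_law_conv_power)
  define D where "D = (\<lambda>s. (real d ^ (2 * d + 2)) powr max 1 (s / 2))"
  define p where "p = (\<lambda>s::real. max 1 (s / 2) * max 1 (2 / s))"
  have D: "0 < D s" for s by (simp add: D_def d_def)
  define L where "L = (\<lambda>n x. root n (u n x * (u (d * n) x / u n x ^ d) powr p (snd x) / D (snd x)))"
  have L_le: "L n x \<le> r x" if "x \<in> topspace X" "1 \<le> n" "0 < u n x" for n x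
  proof -
    have "u n x * (u (d * n) x / u n x ^ d) powr p (snd x) \<le> D (snd x) * r x ^ n"
      using moment_rate_lower_bound[OF law[OF that(1)], of n] that(3)
      unfolding u_def p_def D_def r_def d_def by simp
    then have "u n x * (u (d * n) x / u n x ^ d) powr p (snd x) / D (snd x) \<le> r x ^ n"
      using D[of "snd x"] by (simp add: divide_le_eq mult.commute)
    then have "L n x \<le> root n (r x ^ n)"
      unfolding L_def using that by (intro real_root_le_mono) auto
    then show ?thesis using that r_nonneg by (simp add: real_root_power_cancel)
  qed
  have "(r \<longlongrightarrow> r x0) F"
  proof (rule order_tendstoI)
    fix a assume "r x0 < a"
    then have "\<forall>\<^sub>F n in sequentially. 1 \<le> n \<and> root n (u n x0) < a"
      by (intro eventually_conj eventually_ge_at_top order_tendstoD(2)[OF r_lim[OF x0]])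
    then obtain n where n: "1 \<le> n" "root n (u n x0) < a"
      using eventually_happens'[OF sequentially_bot] by blast
    have "((\<lambda>x. root n (u n x)) \<longlongrightarrow> root n (u n x0)) F"
      by (intro tendsto_intros u_lim)
    from order_tendstoD(2)[OF this n(2)] show "\<forall>\<^sub>F x in F. r x < a"
      by eventually_elim (use r_le[OF n(1)] in \<open>blast intro: le_less_trans\<close>)
  next
    fix a assume a: "a < r x0"
    show "\<forall>\<^sub>F x in F. a < r x"
    proof (cases "a < 0")
      case True
      then show ?thesis using r_nonneg by (auto intro!: always_eventually less_le_trans[of a 0])
    next
      case False
      then have r0: "0 < r x0" using a by simp
      have u_pos: "0 < u n x0" if "1 \<le> n" for n
        using r_le[OF that, of x0] r0 that u_nonneg[of n x0] by (cases "u n x0 = 0") auto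
      have d: "1 \<le> d" unfolding d_def by (simp add: Suc_le_eq)
      let ?w = "\<lambda>n. root n (u n x0)"
      have "(\<lambda>n. ?w (d * n)) \<longlonglongrightarrow> r x0"
        using LIMSEQ_subseq_LIMSEQ[OF r_lim[OF x0], of "\<lambda>n. d * n"] d
        by (simp add: strict_mono_def comp_def)
      then have "(\<lambda>n. ?w n * (?w (d * n) ^ d / ?w n ^ d) powr p (snd x0) / root n (D (snd x0)))
          \<longlonglongrightarrow> r x0 * (r x0 ^ d / r x0 ^ d) powr p (snd x0) / 1"
        using r0 by (intro tendsto_intros r_lim x0 LIMSEQ_root_const D) auto
      also have "r x0 * (r x0 ^ d / r x0 ^ d) powr p (snd x0) / 1 = r x0" using r0 by simp
      finally have lim: "(\<lambda>n. ?w n * (?w (d * n) ^ d / ?w n ^ d) powr p (snd x0) / root n (D (snd x0)))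
          \<longlonglongrightarrow> r x0" .
      have "?w n * (?w (d * n) ^ d / ?w n ^ d) powr p (snd x0) / root n (D (snd x0)) = L n x0" if n: "1 \<le> n" for n
      proof -
        have "?w (d * n) ^ d = root n (u (d * n) x0)"
          using d u_nonneg by (simp add: real_root_mult_exp real_root_ge_zero)
        moreover have "?w n ^ d = root n (u n x0 ^ d)"
          using n u_nonneg by (simp add: real_root_power)
        moreover have "root n (y powr q) = root n y powr q" if "0 \<le> y" for y q
          using n that by (cases "y = 0") (simp_all add: root_powr_inverse powr_powr_swap)
        ultimately show ?thesis
          using n u_nonneg unfolding L_def by (simp add: real_root_mult real_root_divide)
      qed
      with lim have "(\<lambda>n. L n x0) \<longlonglongrightarrow> r x0"
        by (elim Lim_transform_eventually) (auto intro!: eventually_sequentiallyI[of 1])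
      then have "\<forall>\<^sub>F n in sequentially. 1 \<le> n \<and> a < L n x0"
        using a by (intro eventually_conj eventually_ge_at_top order_tendstoD(1))
      then obtain n where n: "1 \<le> n" "a < L n x0"
        using eventually_happens'[OF sequentially_bot] by blast
      have dn: "1 \<le> d * n" using d n(1) by (simp add: Suc_le_eq)
      have "(L n \<longlongrightarrow> L n x0) F"
        unfolding L_def p_def D_def using u_pos[OF n(1)] u_pos[OF dn] law(2)[OF x0]
        by (intro tendsto_intros u_lim s_lim) (auto simp: d_def)
      from order_tendstoD(1)[OF this n(2)] order_tendstoD(1)[OF u_lim u_pos[OF n(1)]] top
      show ?thesis
        by eventually_elim (use L_le[OF _ n(1)] in \<open>blast intro: less_le_trans\<close>)
    qed
  qed
  then show ?thesis by (simp add: r_def F_def)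
qed

theorem theorem2p1:
  shows "continuous_map
           (prod_topology (weak_star_topology :: (real^'n^'n) measure topology)
              (top_of_set {0<..}))
           (top_of_set {..<\<infinity>})
           (\<lambda>(\<mu>, s). norm_pressure \<mu> s)"
proof -
  let ?X = "prod_topology (weak_star_topology :: (real^'n^'n) measure topology)
      (top_of_set {0<..} :: real topology)"
  have "continuous_map ?X (top_of_set {..<\<infinity>}) (\<lambda>x. ln_ext (moment_rate (fst x) (snd x)))"
    unfolding continuous_map_in_subtopology
  proof
    show "continuous_map ?X euclidean (\<lambda>x. ln_ext (moment_rate (fst x) (snd x)))"
      unfolding continuous_map_atin limitin_canonical_iff
      by (intro ballI tendsto_ln_ext moment_rate_continuous)
  qed (auto simp: ln_ext_def)
  then show ?thesis
  proof (rule continuous_map_eq)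
    fix x assume "x \<in> topspace ?X"
    then have "fst x \<in> ball_prob_measures" "0 < snd x"
      by (auto simp: topspace_weak_star_topology)
    then show "ln_ext (moment_rate (fst x) (snd x)) = (case x of (\<mu>, s) \<Rightarrow> norm_pressure \<mu> s)"
      by (simp add: split_beta norm_pressure_eq contractive_law_ball_prob_measures)
  qed
qed

end
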